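(* There is an algorithm which, given positive integers $m,n,k$ and $m$-component birth sequence vectors $\vec d_0,\vec d_1,\dots,\vec d_{n-1}$ generating a forest of $m$ birth sequence trees of height $n$, each with its root initially on fire, determines in \[ O\!\left(m\binom{m+k-1}{m-1}\,n\,(kn)^m\right) \] steps whether it is possible to save all leaves of the forest by protecting at most $k$ vertices on every even turn.
   Context: The depth of a vertex in a rooted tree is its distance from its root. The forest generated by vectors $\vec d_0,\dots,\vec d_{n-1}$ with positive integer components consists of $m$ disjoint rooted trees, labeled $1,\dots,m$, such that for $0\le i\le n-1$ every vertex of Tree $j$ at depth $i$ has exactly as many children as the $j$-th component of $\vec d_i$; the vertices at depth $n$ are the leaves. Firefighter process on a graph with vertex set $V$: $F^{(t)}$ is the set of vertices on fire at turn $t$ and $P^{(t)}$ the set of protected vertices at turn $t$. On turn $1$, $F^{(1)}$ is the given initial fire (here the set of the $m$ roots) and $P^{(1)}=\varnothing$. On an even turn $2t$, the firefighters choose a subset of $V\setminus F^{(2t-1)}$ to protect; $P^{(2t)}$ is the union of $P^{(2t-1)}$ and this subset, and $F^{(2t)}=F^{(2t-1)}$. On an odd turn $2t+1$ with $t\ge 1$, $F^{(2t+1)}=N[F^{(2t)}]\setminus P^{(2t)}$, where $N[\cdot]$ is the closed neighborhood, and $P^{(2t+1)}=P^{(2t)}$. Saving all leaves means that no leaf is ever on fire. A step is an elementary operation (arithmetic, comparison, memory access) on single integers, counted at unit cost. *)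

theory Defs
  imports Main
begin

section \<open>The firefighter process on a graph\<close>

definition closed_nbhd :: "'v set \<Rightarrow> 'v set set \<Rightarrow> 'v set \<Rightarrow> 'v set" where
  "closed_nbhd V E A = A \<union> {v \<in> V. \<exists>u\<in>A. {u, v} \<in> E}"

text \<open>
  Turns are numbered from 1, so the values of \<open>F\<close> and \<open>P\<close> at 0 are irrelevant.
  The set chosen by the firefighters on turn \<open>2 * t\<close> is \<open>S\<close>.
\<close>

definition firefighter_process ::
  "'v set \<Rightarrow> 'v set set \<Rightarrow> 'v set \<Rightarrow> nat \<Rightarrow> (nat \<Rightarrow> 'v set) \<Rightarrow> (nat \<Rightarrow> 'v set) \<Rightarrow> bool" where
  "firefighter_process V E F0 k F P \<longleftrightarrow>
     F 1 = F0 \<and> P 1 = {} \<and>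
     (\<forall>t\<ge>1. (\<exists>S. S \<subseteq> V - F (2 * t - 1) \<and> finite S \<and> card S \<le> k \<and>
                 P (2 * t) = P (2 * t - 1) \<union> S) \<and>
             F (2 * t) = F (2 * t - 1)) \<and>
     (\<forall>t\<ge>1. F (2 * t + 1) = closed_nbhd V E (F (2 * t)) - P (2 * t) \<and>
             P (2 * t + 1) = P (2 * t))"


section \<open>The forest generated by birth sequence vectors\<close>

text \<open>
  A vertex is a pair of a tree label \<open>j < m\<close> and the path of child indices leading to it from the
  root of Tree \<open>j\<close>, so its depth is the length of the path.  The number \<open>d i j\<close> is the \<open>j\<close>-th
  component of the \<open>i\<close>-th vector; labels and components are counted from 0.
\<close>

type_synonym vertex = "nat \<times> nat list"

definition forest_verts :: "nat \<Rightarrow> nat \<Rightarrow> (nat \<Rightarrow> nat \<Rightarrow> nat) \<Rightarrow> vertex set" where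
  "forest_verts m n d =
     {(j, p). j < m \<and> length p \<le> n \<and> (\<forall>i<length p. p ! i < d i j)}"

definition forest_edges :: "nat \<Rightarrow> nat \<Rightarrow> (nat \<Rightarrow> nat \<Rightarrow> nat) \<Rightarrow> vertex set set" where
  "forest_edges m n d =
     {{(j, p), (j, p @ [c])} | j p c. (j, p @ [c]) \<in> forest_verts m n d}"

definition forest_roots :: "nat \<Rightarrow> vertex set" where
  "forest_roots m = {(j, []) | j. j < m}"

definition forest_leaves :: "nat \<Rightarrow> nat \<Rightarrow> (nat \<Rightarrow> nat \<Rightarrow> nat) \<Rightarrow> vertex set" where
  "forest_leaves m n d = {(j, p) \<in> forest_verts m n d. length p = n}"

definition can_save_all_leaves :: "nat \<Rightarrow> nat \<Rightarrow> nat \<Rightarrow> (nat \<Rightarrow> nat \<Rightarrow> nat) \<Rightarrow> bool" where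
  "can_save_all_leaves m n k d \<longleftrightarrow>
     (\<exists>F P. firefighter_process (forest_verts m n d) (forest_edges m n d) (forest_roots m) k F P \<and>
            (\<forall>t\<ge>1. F t \<inter> forest_leaves m n d = {}))"


section \<open>Unit-cost algorithms on integers\<close>

text \<open>
  Algorithms are while-programs on a random access memory.  The memory consists of named arrays
  whose cells hold integers; a program mentions only finitely many names, and a scalar variable is
  cell 0 of an array.  Every constant, memory access, arithmetic operation, comparison, Boolean
  connective and branch costs one step, so array indices are paid for as well.
\<close>

type_synonym name = string
type_synonym mem = "name \<Rightarrow> int \<Rightarrow> int"

datatype arith_op = Plus | Minus | Times | Div | Mod

datatype aexp = Const int | Cell name aexp | Arith arith_op aexp aexp

datatype bexp = Less aexp aexp | Equal aexp aexp | Not bexp | And bexp bexp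

datatype com =
    Skip
  | Assign name aexp aexp  \<comment> \<open>\<open>Assign x a e\<close> stores the value of \<open>e\<close> in cell \<open>a\<close> of the array \<open>x\<close>\<close>
  | Seq com com
  | If bexp com com
  | While bexp com

fun arith_fun :: "arith_op \<Rightarrow> int \<Rightarrow> int \<Rightarrow> int" where
  "arith_fun Plus u v = u + v"
| "arith_fun Minus u v = u - v"
| "arith_fun Times u v = u * v"
| "arith_fun Div u v = u div v"
| "arith_fun Mod u v = u mod v"

fun aval :: "aexp \<Rightarrow> mem \<Rightarrow> int" where
  "aval (Const c) s = c"
| "aval (Cell x a) s = s x (aval a s)"
| "aval (Arith f a b) s = arith_fun f (aval a s) (aval b s)"

fun acost :: "aexp \<Rightarrow> nat" where
  "acost (Const c) = 1"
| "acost (Cell x a) = acost a + 1"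
| "acost (Arith f a b) = acost a + acost b + 1"

fun bval :: "bexp \<Rightarrow> mem \<Rightarrow> bool" where
  "bval (Less a b) s \<longleftrightarrow> aval a s < aval b s"
| "bval (Equal a b) s \<longleftrightarrow> aval a s = aval b s"
| "bval (Not b) s \<longleftrightarrow> \<not> bval b s"
| "bval (And b c) s \<longleftrightarrow> bval b s \<and> bval c s"

fun bcost :: "bexp \<Rightarrow> nat" where
  "bcost (Less a b) = acost a + acost b + 1"
| "bcost (Equal a b) = acost a + acost b + 1"
| "bcost (Not b) = bcost b + 1"
| "bcost (And b c) = bcost b + bcost c + 1"

text \<open>
  \<open>exec c s t s'\<close>: started in memory \<open>s\<close>, the program \<open>c\<close> halts after \<open>t\<close> steps in memory \<open>s'\<close>.
\<close>

inductive exec :: "com \<Rightarrow> mem \<Rightarrow> nat \<Rightarrow> mem \<Rightarrow> bool" where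
  Skip: "exec Skip s 1 s"
| Assign: "exec (Assign x a e) s (acost a + acost e + 1)
             (s(x := (s x)(aval a s := aval e s)))"
| Seq: "exec c1 s t1 s' \<Longrightarrow> exec c2 s' t2 s'' \<Longrightarrow> exec (Seq c1 c2) s (t1 + t2) s''"
| IfTrue: "bval b s \<Longrightarrow> exec c1 s t s' \<Longrightarrow> exec (If b c1 c2) s (bcost b + 1 + t) s'"
| IfFalse: "\<not> bval b s \<Longrightarrow> exec c2 s t s' \<Longrightarrow> exec (If b c1 c2) s (bcost b + 1 + t) s'"
| WhileFalse: "\<not> bval b s \<Longrightarrow> exec (While b c) s (bcost b + 1) s"
| WhileTrue: "bval b s \<Longrightarrow> exec c s t1 s' \<Longrightarrow> exec (While b c) s' t2 s'' \<Longrightarrow>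
              exec (While b c) s (bcost b + 1 + t1 + t2) s''"

lemma exec_deterministic:
  "exec c s t s' \<Longrightarrow> exec c s u s'' \<Longrightarrow> u = t \<and> s'' = s'"
proof (induction arbitrary: u s'' rule: exec.induct)
  case (Seq c1 s t1 s' c2 t2 s2)
  from Seq.prems show ?case by cases (use Seq.IH in blast)
next
  case (IfTrue b s c1 t s' c2)
  from IfTrue.prems show ?case by cases (use IfTrue in blast)+
next
  case (IfFalse b s c2 t s' c1)
  from IfFalse.prems show ?case by cases (use IfFalse in blast)+
next
  case (WhileTrue b s c t1 s' t2 s2)
  from WhileTrue.prems show ?case by cases (use WhileTrue in blast)+
qed (erule exec.cases; simp)+

text \<open>
  The input vectors are stored one after the other: component \<open>j\<close> of the \<open>i\<close>-th vector is cell
  \<open>i * m + j\<close> of the input array.  All cells that do not hold input are 0.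
\<close>

definition input_mem :: "nat \<Rightarrow> nat \<Rightarrow> nat \<Rightarrow> (nat \<Rightarrow> nat \<Rightarrow> nat) \<Rightarrow> mem" where
  "input_mem m n k d = (\<lambda>x a.
     if x = ''m'' \<and> a = 0 then int m
     else if x = ''n'' \<and> a = 0 then int n
     else if x = ''k'' \<and> a = 0 then int k
     else if x = ''d'' \<and> 0 \<le> a \<and> a < int (n * m) then int (d (nat a div m) (nat a mod m))
     else 0)"

end

theory Submission
  imports Defs Complex_Main
begin

text \<open>
  In a tree it never helps to protect a vertex before the fire is about to reach it: a firefighter
  placed below that level saves no more leaves than one placed on the ancestor that is next to the
  fire.  All vertices of one level of a tree look alike, so only the numbers of burning vertices
  matter.  If \<open>u\<close> vertices at depth \<open>i\<close> of Tree \<open>j\<close> burn and \<open>x\<close> firefighters are then sent to that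
  tree, \<open>u * d i j - x\<close> vertices burn at depth \<open>i + 1\<close>, and the leaves are saved iff this number,
  which may be allowed to become negative, is at most 0 at depth \<open>n\<close> for every tree
  (\<open>burning_le_zero_if_can_save\<close>, \<open>can_save_if_burning_le_zero\<close>).

  Firefighters are placed one at a time, in \<open>K = k * n\<close> steps; the birth number \<open>factor k d t j\<close> of
  a step \<open>t\<close> is \<open>d i j\<close> when level \<open>i\<close> begins at that step and 1 otherwise.  The question is solved
  backwards: the numbers can be brought to at most \<open>V j\<close> after a step in which Tree \<open>c\<close> gets the
  firefighter iff they can be brought to at most \<open>(V j + [c = j]) div factor k d t j\<close> before it
  (\<open>feasible\<close>, \<open>feasible_iff_burning\<close>).  Starting from the thresholds 0 after step \<open>K\<close>, every
  threshold before that is between 0 and \<open>K\<close>, because each step adds at most 1.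

  The program tabulates, for \<open>t = 1, ..., K\<close> and for all thresholds of the trees other than the last
  one, the least threshold of the last tree that can be met.  Leaving one tree out of the index saves
  a factor of \<open>K + 1\<close>: there are \<open>(K + 1) ^ (m - 1)\<close> cells per step, and each is computed from \<open>m\<close>
  cells of the previous step, whose indices take \<open>O(m)\<close> steps to find.  This gives
  \<open>O(K * (K + 1) ^ (m - 1) * m * m)\<close> steps (\<open>wp_sweep\<close>).  If \<open>m > K\<close>, some tree never gets a firefighter
  and the answer is no (\<open>not_feasible_zero\<close>); otherwise \<open>(K + 1) ^ (m - 1) \<le> 3 * K ^ (m - 1)\<close>,
  since \<open>(1 + 1 / K) ^ K \<le> exp 1\<close>.  Finally \<open>m \<le> (m + k - 1) choose (m - 1)\<close>, so the bound is met.
\<close>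

section \<open>Numbers of burning vertices\<close>

text \<open>
  The number of burning vertices of Tree \<open>j\<close> at the depth that the fire has reached, if step \<open>t\<close> multiplies
  it by \<open>D t j\<close> and then sends one firefighter to Tree \<open>c t\<close>.  Once it is at most 0 it stays so, because
  the factors are not negative; hence it need not be cut off at 0.
\<close>

fun burning :: "(nat \<Rightarrow> nat \<Rightarrow> nat) \<Rightarrow> (nat \<Rightarrow> nat) \<Rightarrow> nat \<Rightarrow> nat \<Rightarrow> int" where
  "burning D c 0 j = 1"
| "burning D c (Suc t) j = burning D c t j * int (D t j) - of_bool (c t = j)"

definition factor :: "nat \<Rightarrow> (nat \<Rightarrow> nat \<Rightarrow> nat) \<Rightarrow> nat \<Rightarrow> nat \<Rightarrow> nat" where
  "factor k d t j = (if t mod k = 0 then d (t div k) j else 1)"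

text \<open>
  A block of \<open>k\<close> steps is one turn of the firefighters: only the first of its factors can differ from 1.
\<close>

lemma burning_level:
  assumes "k \<ge> 1"
  shows "burning (factor k d) c (i * k + k) j =
    burning (factor k d) c (i * k) j * int (d i j) - int (card {l. l < k \<and> c (i * k + l) = j})"
proof -
  have "burning (factor k d) c (i * k + Suc l) j =
    burning (factor k d) c (i * k) j * int (d i j) - int (card {l'. l' < Suc l \<and> c (i * k + l') = j})"
    if "l < k" for l
    using that
  proof (induction l)
    case 0
    have "{l'. l' < Suc 0 \<and> c (i * k + l') = j} = (if c (i * k) = j then {0} else {})" by auto
    then show ?case using assms by (simp add: factor_def)
  next
    case (Suc l)
    have "{l'. l' < Suc (Suc l) \<and> c (i * k + l') = j} =
      (if c (i * k + Suc l) = j then insert (Suc l) {l'. l' < Suc l \<and> c (i * k + l') = j}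
       else {l'. l' < Suc l \<and> c (i * k + l') = j})"
      by (auto simp: less_Suc_eq)
    moreover have "factor k d (i * k + Suc l) j = 1"
      using Suc.prems by (simp add: factor_def mod_Suc)
    ultimately show ?case using Suc by simp
  qed
  from this[of "k - 1"] show ?thesis using assms by simp
qed

section \<open>The process compared with the numbers\<close>

lemma finite_forest_verts: "finite (forest_verts m n d)"
proof -
  let ?M = "\<Sum>i<n. \<Sum>j<m. d i j"
  have "p ! i < ?M" if "(j, p) \<in> forest_verts m n d" "i < length p" for j p i
  proof -
    have "p ! i < d i j" "i < n" "j < m" using that by (auto simp: forest_verts_def)
    moreover have "d i j \<le> (\<Sum>j<m. d i j)" using \<open>j < m\<close> by (intro member_le_sum) auto
    moreover have "(\<Sum>j<m. d i j) \<le> ?M"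
      using \<open>i < n\<close> by (intro member_le_sum[of i _ "\<lambda>i. \<Sum>j<m. d i j"]) auto
    ultimately show ?thesis by linarith
  qed
  then have "forest_verts m n d \<subseteq> {..<m} \<times> {p. set p \<subseteq> {..<?M} \<and> length p \<le> n}"
    by (auto simp: forest_verts_def in_set_conv_nth)
  then show ?thesis
    by (rule finite_subset) (intro finite_cartesian_product finite_lists_length_le; simp)
qed

lemma forest_verts_snoc:
  "(j, p @ [a]) \<in> forest_verts m n d \<longleftrightarrow>
     (j, p) \<in> forest_verts m n d \<and> length p < n \<and> a < d (length p) j"
  by (auto simp: forest_verts_def nth_append less_Suc_eq split: if_splits)

text \<open>
  Replace each vertex that is protected on turn \<open>2 * t\<close> and lies below depth \<open>t\<close> by its ancestor at
  depth \<open>t\<close>, and send a firefighter to the tree of each protected vertex.  The leaves below a vertex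
  lie below its ancestor as well, so the replaced strategy still saves every leaf, and in each level
  it takes away at most one vertex per firefighter.
\<close>

lemma burning_le_zero_if_can_save:
  assumes k: "k \<ge> 1" and m: "m \<ge> 1" and save: "can_save_all_leaves m n k d"
  shows "\<exists>c. (\<forall>i. c i < m) \<and> (\<forall>j<m. burning (factor k d) c (n * k) j \<le> 0)"
proof -
  let ?V = "forest_verts m n d"
  from save obtain F P where
    proc: "firefighter_process ?V (forest_edges m n d) (forest_roots m) k F P" and
    leaf: "\<And>t. t \<ge> 1 \<Longrightarrow> F t \<inter> forest_leaves m n d = {}"
    unfolding can_save_all_leaves_def by blast
  have F1: "F 1 = forest_roots m" and P1: "P 1 = {}"
    and Fe: "\<And>t. t \<ge> 1 \<Longrightarrow> F (2 * t) = F (2 * t - 1)"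
    and Fo: "\<And>t. t \<ge> 1 \<Longrightarrow>
      F (2 * t + 1) = closed_nbhd ?V (forest_edges m n d) (F (2 * t)) - P (2 * t)"
    and Po: "\<And>t. t \<ge> 1 \<Longrightarrow> P (2 * t + 1) = P (2 * t)"
    using proc unfolding firefighter_process_def by simp_all
  have step: "\<exists>S. S \<subseteq> ?V - F (2 * t - 1) \<and> finite S \<and> card S \<le> k \<and> P (2 * t) = P (2 * t - 1) \<union> S"
    if "t \<ge> 1" for t
    using proc that unfolding firefighter_process_def by (elim conjE allE[of _ t]) simp
  have "\<forall>t. \<exists>S. t \<ge> 1 \<longrightarrow> S \<subseteq> ?V \<and> finite S \<and> card S \<le> k \<and> P (2 * t) = P (2 * t - 1) \<union> S"
  proof
    fix t
    show "\<exists>S. t \<ge> 1 \<longrightarrow> S \<subseteq> ?V \<and> finite S \<and> card S \<le> k \<and> P (2 * t) = P (2 * t - 1) \<union> S"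
      using step[of t] by (cases "t \<ge> 1") (blast, simp)
  qed
  from choice[OF this] obtain S where
    "\<forall>t. t \<ge> 1 \<longrightarrow> S t \<subseteq> ?V \<and> finite (S t) \<and> card (S t) \<le> k \<and> P (2 * t) = P (2 * t - 1) \<union> S t"
    by (rule exE)
  then have S: "S t \<subseteq> ?V" "finite (S t)" "card (S t) \<le> k" "P (2 * t) = P (2 * t - 1) \<union> S t"
    if "t \<ge> 1" for t using that by blast+
  have P_sub: "P (2 * Suc t) \<subseteq> (\<Union>l\<in>{1..Suc t}. S l)" for t
  proof (induction t)
    case 0
    then show ?case using S(4)[of 1] P1 by simp
  next
    case (Suc t)
    have "P (2 * Suc (Suc t)) = P (2 * Suc t) \<union> S (Suc (Suc t))"
      using S(4)[of "Suc (Suc t)"] Po[of "Suc t"] by simp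
    with Suc show ?case by fastforce
  qed
  \<comment> \<open>A vertex burns as soon as it can unless the path to it is blocked in time.\<close>
  have burn: "(j, p) \<in> F (2 * length p + 1)"
    if "(j, p) \<in> ?V" "\<And>l. 1 \<le> l \<Longrightarrow> l \<le> length p \<Longrightarrow> (j, take l p) \<notin> P (2 * l)" for j p
    using that
  proof (induction p rule: rev_induct)
    case Nil
    then show ?case using F1 by (auto simp: forest_roots_def forest_verts_def)
  next
    case (snoc a p)
    have "(j, take l p) \<notin> P (2 * l)" if "1 \<le> l" "l \<le> length p" for l
      using snoc.prems(2)[of l] that by simp
    then have "(j, p) \<in> F (2 * length p + 1)"
      using snoc by (simp add: forest_verts_snoc)
    then have "(j, p) \<in> F (2 * Suc (length p))" using Fe[of "Suc (length p)"] by simp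
    moreover have "{(j, p), (j, p @ [a])} \<in> forest_edges m n d"
      unfolding forest_edges_def using snoc.prems(1) by blast
    ultimately have "(j, p @ [a]) \<in> closed_nbhd ?V (forest_edges m n d) (F (2 * Suc (length p)))"
      unfolding closed_nbhd_def using snoc.prems(1) by blast
    moreover have "(j, p @ [a]) \<notin> P (2 * Suc (length p))"
      using snoc.prems(2)[of "Suc (length p)"] by simp
    ultimately show ?case using Fo[of "Suc (length p)"] by simp
  qed
  \<comment> \<open>\<open>A t\<close> holds the ancestors that replace the vertices of \<open>S t\<close>; \<open>b i j\<close> holds what then still burns.\<close>
  define A where "A t = (\<lambda>(j, p). (j, take t p)) ` S t" for t
  define b where "b i j = {p. (j, p) \<in> ?V \<and> length p = i \<and> (\<forall>l\<in>{1..i}. (j, take l p) \<notin> A l)}" for i j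
  have bn: "b n j = {}" for j
  proof (rule ccontr)
    assume "b n j \<noteq> {}"
    then obtain p where p: "(j, p) \<in> ?V" "length p = n" "\<And>l. l \<in> {1..n} \<Longrightarrow> (j, take l p) \<notin> A l"
      unfolding b_def by blast
    have "(j, take l p) \<notin> P (2 * l)" if l: "1 \<le> l" "l \<le> length p" for l
    proof
      assume "(j, take l p) \<in> P (2 * l)"
      then obtain l' where l': "l' \<in> {1..l}" "(j, take l p) \<in> S l'"
        using P_sub[of "l - 1"] l by auto
      then have "(j, take l' (take l p)) \<in> A l'" unfolding A_def by force
      with l' p l show False by (simp add: min_def split: if_splits)
    qed
    from burn[OF p(1) this] have "(j, p) \<in> F (2 * n + 1)" using p by simp
    with leaf[of "2 * n + 1"] p show False by (auto simp: forest_leaves_def)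
  qed
  \<comment> \<open>The firefighters of each turn are numbered; an idle one is sent to Tree 0.\<close>
  have "\<exists>e. S (Suc i) \<subseteq> e ` {..<k} \<and> (\<forall>l. fst (e l) < m)" for i
  proof -
    obtain g where g: "bij_betw g {0..<card (S (Suc i))} (S (Suc i))"
      using ex_bij_betw_nat_finite[OF S(2)[of "Suc i"]] by auto
    define e where "e l = (if l < card (S (Suc i)) then g l else (0, []))" for l
    have "g l \<in> S (Suc i)" if "l < card (S (Suc i))" for l
      using g that by (auto simp: bij_betw_def)
    moreover have "S (Suc i) \<subseteq> ?V" using S(1) by simp
    ultimately have "fst (e l) < m" for l
      using m by (fastforce simp: e_def forest_verts_def)
    moreover have "S (Suc i) \<subseteq> e ` {..<k}"
    proof
      fix v assume "v \<in> S (Suc i)"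
      then have "v \<in> g ` {0..<card (S (Suc i))}" using g by (simp add: bij_betw_def)
      then obtain l where "l < card (S (Suc i))" "g l = v" by auto
      then show "v \<in> e ` {..<k}" using S(3)[of "Suc i"] by (force simp: e_def)
    qed
    ultimately show ?thesis by blast
  qed
  then obtain e where e: "\<And>i. S (Suc i) \<subseteq> e i ` {..<k}" "\<And>i l. fst (e i l) < m" by metis
  define c where "c t = fst (e (t div k) (t mod k))" for t
  have c_eq: "c (i * k + l) = fst (e i l)" if "l < k" for i l using that by (simp add: c_def)
  have fin_b: "finite (b i j)" for i j
  proof -
    have "b i j \<subseteq> snd ` ?V" unfolding b_def by force
    then show ?thesis using finite_forest_verts finite_surj by blast
  qed
  have "burning (factor k d) c (i * k) j \<le> int (card (b i j))" if "i \<le> n" "j < m" for i j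
    using that(1)
  proof (induction i)
    case 0
    have "b 0 j = {[]}" using that by (auto simp: b_def forest_verts_def)
    then show ?case by simp
  next
    case (Suc i)
    let ?X = "{l. l < k \<and> c (i * k + l) = j}" and ?Y = "{p. (j, p) \<in> A (Suc i)}"
    have sub: "(\<lambda>(p, a). p @ [a]) ` (b i j \<times> {..<d i j}) \<subseteq> b (Suc i) j \<union> ?Y"
    proof
      fix q assume "q \<in> (\<lambda>(p, a). p @ [a]) ` (b i j \<times> {..<d i j})"
      then obtain p a where q: "q = p @ [a]" and p: "p \<in> b i j" and a: "a < d i j" by auto
      show "q \<in> b (Suc i) j \<union> ?Y"
      proof (cases "q \<in> ?Y")
        case False
        then have "(j, take l q) \<notin> A l" if "l \<in> {1..Suc i}" for l
          using that p by (cases "l = Suc i") (auto simp: b_def q)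
        then show ?thesis using p a Suc.prems by (simp add: b_def forest_verts_snoc q)
      qed simp
    qed
    have Y: "?Y \<subseteq> (\<lambda>l. take (Suc i) (snd (e i l))) ` ?X"
    proof
      fix p assume "p \<in> ?Y"
      then obtain q where q: "(j, q) \<in> S (Suc i)" "p = take (Suc i) q" by (auto simp: A_def)
      then have "(j, q) \<in> e i ` {..<k}" using e(1)[of i] by blast
      then obtain l where l: "l < k" "e i l = (j, q)" by auto
      then have "l \<in> ?X" using c_eq[of l i] by simp
      with l q show "p \<in> (\<lambda>l. take (Suc i) (snd (e i l))) ` ?X" by force
    qed
    have "card (b i j) * d i j = card ((\<lambda>(p, a). p @ [a]) ` (b i j \<times> {..<d i j}))"
      by (subst card_image) (auto simp: inj_on_def card_cartesian_product)
    also have "\<dots> \<le> card (b (Suc i) j \<union> ?Y)"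
      using sub fin_b finite_subset[OF Y] by (intro card_mono) auto
    also have "\<dots> \<le> card (b (Suc i) j) + card ?Y" by (rule card_Un_le)
    also have "card ?Y \<le> card ?X"
      using Y by (intro surj_card_le) auto
    finally have "card (b i j) * d i j \<le> card (b (Suc i) j) + card ?X" by simp
    then have "int (card (b i j)) * int (d i j) \<le> int (card (b (Suc i) j)) + int (card ?X)"
      by (simp flip: of_nat_mult of_nat_add)
    moreover have "burning (factor k d) c (i * k) j * int (d i j) \<le> int (card (b i j)) * int (d i j)"
      using Suc by (intro mult_right_mono) auto
    ultimately show ?case using burning_level[OF k, of d c i j] by (simp add: add.commute)
  qed
  from this[of n] have "burning (factor k d) c (n * k) j \<le> 0" if "j < m" for j
    using that by (simp add: bn)
  moreover have "c i < m" for i by (simp add: c_def e(2))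
  ultimately show ?thesis by (intro exI[of _ c]) blast
qed

lemma ex_quota_subset:
  fixes x :: "nat \<Rightarrow> nat" and A :: "vertex set"
  assumes "finite A" "(\<Sum>j<m. x j) \<le> k"
  shows "\<exists>S\<subseteq>A. card S \<le> k \<and>
    (\<forall>j<m. card {v \<in> A - S. fst v = j} \<le> card {v \<in> A. fst v = j} - x j)"
proof -
  have "\<forall>j. \<exists>S. S \<subseteq> {v \<in> A. fst v = j} \<and> card S = min (x j) (card {v \<in> A. fst v = j})"
  proof
    fix j
    show "\<exists>S. S \<subseteq> {v \<in> A. fst v = j} \<and> card S = min (x j) (card {v \<in> A. fst v = j})"
      by (rule obtain_subset_with_card_n[of "min (x j) (card {v \<in> A. fst v = j})" "{v \<in> A. fst v = j}"]) auto
  qed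
  from choice[OF this] obtain S where
    "\<forall>j. S j \<subseteq> {v \<in> A. fst v = j} \<and> card (S j) = min (x j) (card {v \<in> A. fst v = j})"
    by (rule exE)
  then have S: "S j \<subseteq> {v \<in> A. fst v = j}" "card (S j) = min (x j) (card {v \<in> A. fst v = j})" for j
    by simp_all
  have fin: "finite (S j)" for j using S(1)[of j] assms by (auto intro: finite_subset)
  have "card (\<Union>j<m. S j) \<le> (\<Sum>j<m. card (S j))" by (rule card_UN_le) simp
  also have "\<dots> \<le> (\<Sum>j<m. x j)" by (rule sum_mono) (simp add: S)
  finally have "card (\<Union>j<m. S j) \<le> k" using assms by linarith
  moreover have "card {v \<in> A - (\<Union>j<m. S j). fst v = j} \<le> card {v \<in> A. fst v = j} - x j" if "j < m" for j
  proof -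
    have "{v \<in> A - (\<Union>j<m. S j). fst v = j} \<subseteq> {v \<in> A. fst v = j} - S j" using that by auto
    then have "card {v \<in> A - (\<Union>j<m. S j). fst v = j} \<le> card ({v \<in> A. fst v = j} - S j)"
      using assms by (intro card_mono) auto
    also have "\<dots> = card {v \<in> A. fst v = j} - card (S j)" by (rule card_Diff_subset[OF fin S(1)])
    finally show ?thesis using S(2)[of j] by simp
  qed
  ultimately show ?thesis using S(1) by (intro exI[of _ "\<Union>j<m. S j"]) blast
qed

text \<open>
  The strategy protects children of burning vertices only, as many in each tree as the assignment
  \<open>c\<close> prescribes, or all of them if there are fewer.
\<close>

lemma can_save_if_burning_le_zero:
  assumes k: "k \<ge> 1" and le_zero: "\<And>j. j < m \<Longrightarrow> burning (factor k d) c (n * k) j \<le> 0"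
  shows "can_save_all_leaves m n k d"
proof -
  let ?V = "forest_verts m n d" and ?E = "forest_edges m n d"
  define x where "x i j = card {l. l < k \<and> c (i * k + l) = j}" for i j
  have x_sum: "(\<Sum>j<m. x i j) \<le> k" for i
  proof -
    have "(\<Sum>j<m. x i j) = card (\<Union>j<m. {l. l < k \<and> c (i * k + l) = j})"
      unfolding x_def by (subst card_UN_disjoint) auto
    also have "\<dots> \<le> card {..<k}" by (intro card_mono) auto
    finally show ?thesis by simp
  qed
  have ex_sel: "\<exists>S. finite A \<longrightarrow> S \<subseteq> A \<and> card S \<le> k \<and>
    (\<forall>j<m. card {v \<in> A - S. fst v = j} \<le> card {v \<in> A. fst v = j} - x i j)" for i and A :: "vertex set"
    using ex_quota_subset[OF _ x_sum, of A i] by blast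
  define sel where "sel i A = (SOME S. finite A \<longrightarrow> S \<subseteq> A \<and> card S \<le> k \<and>
    (\<forall>j<m. card {v \<in> A - S. fst v = j} \<le> card {v \<in> A. fst v = j} - x i j))" for i and A :: "vertex set"
  have sel: "sel i A \<subseteq> A" "card (sel i A) \<le> k"
    "\<And>j. j < m \<Longrightarrow> card {v \<in> A - sel i A. fst v = j} \<le> card {v \<in> A. fst v = j} - x i j"
    if "finite A" for i A
    using someI_ex[OF ex_sel[of A i]] that unfolding sel_def by blast+
  define kids where "kids A = {(j, p @ [a]) | j p a. (j, p) \<in> A \<and> (j, p @ [a]) \<in> ?V}" for A
  \<comment> \<open>\<open>b i\<close> are the vertices that catch fire at depth \<open>i\<close>, on turn \<open>2 * i + 1\<close>; \<open>S i\<close> is protected on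
    turn \<open>2 * (i + 1)\<close>.\<close>
  define b where "b = rec_nat (forest_roots m) (\<lambda>i A. kids A - sel i (kids A))"
  define S where "S i = sel i (kids (b i))" for i
  have b0: "b 0 = forest_roots m" and bSuc: "b (Suc i) = kids (b i) - S i" for i
    by (simp_all add: b_def S_def)
  have kids_V: "kids A \<subseteq> ?V" for A by (auto simp: kids_def)
  have kids_fin: "finite (kids A)" for A using kids_V finite_forest_verts finite_subset by blast
  have S_sub: "S i \<subseteq> kids (b i)" and S_card: "card (S i) \<le> k" for i
    using sel kids_fin by (simp_all add: S_def)
  have b_len: "length (snd v) = i" if "v \<in> b i" for i v
    using that by (induction i arbitrary: v) (auto simp: b0 bSuc forest_roots_def kids_def)
  have kids_len: "length (snd v) = Suc i" if "v \<in> kids (b i)" for i v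
    using that b_len by (force simp: kids_def)
  have b_V: "b i \<subseteq> ?V" for i
    using kids_V by (cases i) (auto simp: b0 bSuc forest_roots_def forest_verts_def)
  have b_fin: "finite (b i)" for i using b_V finite_forest_verts finite_subset by blast
  have card_b: "int (card {v \<in> b i. fst v = j}) \<le> max 0 (burning (factor k d) c (i * k) j)"
    if "i \<le> n" "j < m" for i j
    using that(1)
  proof (induction i)
    case 0
    have "{v \<in> b 0. fst v = j} = {(j, [])}" using that by (auto simp: b0 forest_roots_def)
    then show ?case by simp
  next
    case (Suc i)
    let ?u = "burning (factor k d) c (i * k) j"
    have "{v \<in> kids (b i). fst v = j} \<subseteq>
      (\<lambda>(v, a). (j, snd v @ [a])) ` ({v \<in> b i. fst v = j} \<times> {..<d i j})"
    proof
      fix v assume "v \<in> {v \<in> kids (b i). fst v = j}"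
      then obtain p a where v: "v = (j, p @ [a])" "(j, p) \<in> b i" "v \<in> ?V" by (auto simp: kids_def)
      then have "a < d i j" using b_len[of "(j, p)" i] by (auto simp: forest_verts_snoc)
      with v show "v \<in> (\<lambda>(v, a). (j, snd v @ [a])) ` ({v \<in> b i. fst v = j} \<times> {..<d i j})"
        by force
    qed
    then have "card {v \<in> kids (b i). fst v = j} \<le> card ({v \<in> b i. fst v = j} \<times> {..<d i j})"
      using b_fin by (intro surj_card_le) auto
    then have *: "card {v \<in> kids (b i). fst v = j} \<le> card {v \<in> b i. fst v = j} * d i j"
      by (simp add: card_cartesian_product)
    have "card {v \<in> b (Suc i). fst v = j} \<le> card {v \<in> kids (b i). fst v = j} - x i j"
      unfolding bSuc S_def by (rule sel(3)[OF kids_fin that(2)])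
    with * have "int (card {v \<in> b (Suc i). fst v = j}) \<le>
        max 0 (int (card {v \<in> b i. fst v = j} * d i j) - int (x i j))"
      by linarith
    also have "int (card {v \<in> b i. fst v = j} * d i j) \<le> max 0 ?u * int (d i j)"
      using Suc by (simp add: mult_right_mono)
    also have "max 0 ?u * int (d i j) - int (x i j) \<le> max 0 (?u * int (d i j) - int (x i j))"
      by (cases "?u \<ge> 0") auto
    finally show ?case
      using burning_level[OF k, of d c i j] by (simp add: x_def add.commute)
  qed
  have bn: "b n = {}"
  proof (rule ccontr)
    assume "b n \<noteq> {}"
    then obtain v where v: "v \<in> b n" by blast
    then have "fst v < m" using b_V by (force simp: forest_verts_def)
    then have "card {w \<in> b n. fst w = fst v} = 0"
      using card_b[of n "fst v"] le_zero[of "fst v"] by simp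
    then have "{w \<in> b n. fst w = fst v} = {}" using b_fin by simp
    with v show False by blast
  qed
  define F where "F t = (\<Union>i\<in>{..(t - 1) div 2}. b i)" for t :: nat
  define P where "P t = (\<Union>i\<in>{..<t div 2}. S i)" for t :: nat
  have Fe: "F (2 * t) = (\<Union>i<t. b i)" and Fo: "F (2 * t - 1) = (\<Union>i<t. b i)"
    and Fo': "F (2 * t + 1) = (\<Union>i\<le>t. b i)" if "t \<ge> 1" for t
  proof -
    have "(2 * t - 1) div 2 = t - 1" "(2 * t - 1 - 1) div 2 = t - 1" "{..t-1} = {..<t}"
      using that by auto
    then show "F (2 * t) = (\<Union>i<t. b i)" "F (2 * t - 1) = (\<Union>i<t. b i)" by (simp_all add: F_def)
  qed (simp add: F_def)
  have Pe: "P (2 * t) = (\<Union>i<t. S i)" and Po: "P (2 * t + 1) = (\<Union>i<t. S i)" for t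
    by (simp_all add: P_def)
  have spread: "(\<Union>i\<le>t. b i) = closed_nbhd ?V ?E (\<Union>i<t. b i) - (\<Union>i<t. S i)" (is "?L = ?R")
    if t: "t \<ge> 1" for t
  proof
    show "?L \<subseteq> ?R"
    proof
      fix v assume "v \<in> ?L"
      then obtain i where i: "i \<le> t" "v \<in> b i" by blast
      have "v \<notin> S l" for l
      proof
        assume vl: "v \<in> S l"
        then have "i = Suc l" using kids_len[of v l] b_len[of v i] S_sub[of l] i by auto
        with i vl show False by (simp add: bSuc)
      qed
      moreover have "v \<in> closed_nbhd ?V ?E (\<Union>i<t. b i)"
      proof (cases "i < t")
        case True
        with i show ?thesis by (auto simp: closed_nbhd_def)
      next
        case False
        then obtain l where l: "i = Suc l" "l < t" using i t by (cases i) auto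
        then obtain j p a where v: "v = (j, p @ [a])" "(j, p) \<in> b l" "v \<in> ?V"
          using i by (auto simp: bSuc kids_def)
        then have "{(j, p), v} \<in> ?E" by (auto simp: forest_edges_def)
        with v l show ?thesis unfolding closed_nbhd_def by blast
      qed
      ultimately show "v \<in> ?R" by blast
    qed
    show "?R \<subseteq> ?L"
    proof
      fix v assume v: "v \<in> ?R"
      show "v \<in> ?L"
      proof (cases "v \<in> (\<Union>i<t. b i)")
        case True
        then show ?thesis by force
      next
        case False
        then obtain i u where u: "i < t" "u \<in> b i" "{u, v} \<in> ?E" "v \<in> ?V"
          using v by (auto simp: closed_nbhd_def)
        then obtain j p a where e: "{u, v} = {(j, p), (j, p @ [a])}" "(j, p @ [a]) \<in> ?V"
          by (auto simp: forest_edges_def)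
        then consider "u = (j, p)" "v = (j, p @ [a])" | "u = (j, p @ [a])" "v = (j, p)"
          by (auto simp: doubleton_eq_iff)
        then show ?thesis
        proof cases
          case 1
          then have "v \<in> kids (b i)" using u e by (auto simp: kids_def)
          then have "v \<in> b (Suc i)" using v u by (auto simp: bSuc)
          with u show ?thesis by (auto intro!: bexI[of _ "Suc i"])
        next
          case 2
          have "i = Suc (i - 1)" using b_len[OF u(2)] 2 by auto
          then have "u \<in> kids (b (i - 1))" using u(2) bSuc[of "i - 1"] by auto
          then have "v \<in> b (i - 1)" using 2 by (auto simp: kids_def)
          with u show ?thesis by (auto intro!: bexI[of _ "i - 1"])
        qed
      qed
    qed
  qed
  have "firefighter_process ?V ?E (forest_roots m) k F P"
    unfolding firefighter_process_def
  proof (intro conjI allI impI)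
    show "F 1 = forest_roots m" by (simp add: F_def b0)
    show "P 1 = {}" by (simp add: P_def)
  next
    fix t :: nat assume t: "1 \<le> t"
    show "F (2 * t) = F (2 * t - 1)" using Fe[OF t] Fo[OF t] by simp
    show "F (2 * t + 1) = closed_nbhd ?V ?E (F (2 * t)) - P (2 * t)"
      using Fe[OF t] Fo'[OF t] Pe spread[OF t] by simp
    show "P (2 * t + 1) = P (2 * t)" using Pe Po by simp
    obtain l where l: "t = Suc l" using t by (cases t) auto
    have "P (2 * t) = P (2 * t - 1) \<union> S l"
      using Pe[of t] Po[of l] by (auto simp: l less_Suc_eq)
    moreover have "S l \<inter> b i = {}" if "i < t" for i
      using that kids_len[of _ l] S_sub[of l] b_len[of _ i] by (force simp: l)
    then have "S l \<subseteq> ?V - F (2 * t - 1)"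
      using Fo[OF t] S_sub[of l] kids_V[of "b l"] by auto
    moreover have "finite (S l)" using S_sub kids_fin finite_subset by blast
    ultimately show "\<exists>S. S \<subseteq> ?V - F (2 * t - 1) \<and> finite S \<and> card S \<le> k \<and>
      P (2 * t) = P (2 * t - 1) \<union> S" using S_card by blast
  qed
  moreover have "F t \<inter> forest_leaves m n d = {}" for t
  proof -
    have "v \<notin> forest_leaves m n d" if "v \<in> b i" for v i
      using b_len[OF that] bn that by (auto simp: forest_leaves_def)
    then show ?thesis by (auto simp: F_def)
  qed
  ultimately show ?thesis unfolding can_save_all_leaves_def by blast
qed

section \<open>Thresholds\<close>

text \<open>
  Whether some choice of \<open>t\<close> trees leaves at most \<open>V j\<close> burning vertices in each Tree \<open>j < m\<close>.  The
  recursion goes backwards from the last step, so that \<open>V\<close> stays a vector of small numbers no matter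
  how large the factors are.
\<close>

fun feasible :: "nat \<Rightarrow> (nat \<Rightarrow> nat \<Rightarrow> nat) \<Rightarrow> nat \<Rightarrow> (nat \<Rightarrow> nat) \<Rightarrow> bool" where
  "feasible m D 0 V \<longleftrightarrow> (\<forall>j<m. 1 \<le> V j)"
| "feasible m D (Suc t) V \<longleftrightarrow>
     (\<exists>c<m. feasible m D t (\<lambda>j. (V j + of_bool (c = j)) div D t j))"

lemma feasible_cong:
  "(\<And>j. j < m \<Longrightarrow> V j = W j) \<Longrightarrow> feasible m D t V \<longleftrightarrow> feasible m D t W"
proof (induction t arbitrary: V W)
  case (Suc t)
  have "feasible m D t (\<lambda>j. (V j + of_bool (c = j)) div D t j) \<longleftrightarrow>
        feasible m D t (\<lambda>j. (W j + of_bool (c = j)) div D t j)" for c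
    by (rule Suc.IH) (simp add: Suc.prems)
  then show ?case by simp
qed simp

text \<open>
  Undoing one step: this is what turns a bound after the step into a bound before it.
\<close>

lemma le_div_iff_mult_le_add:
  fixes u :: int
  assumes "D > 0"
  shows "u * int D - of_bool P \<le> int v \<longleftrightarrow> u \<le> int ((v + of_bool P) div D)"
proof -
  have "u \<le> int ((v + of_bool P) div D) \<longleftrightarrow> u * int D \<le> int (v + of_bool P)"
  proof (cases "u \<ge> 0")
    case True
    then obtain w where "u = int w" using zero_le_imp_eq_int by blast
    then show ?thesis
      using assms less_eq_div_iff_mult_less_eq[of D w "v + of_bool P"]
      by (metis of_nat_le_iff of_nat_mult)
  next
    case False
    then have "u * int D \<le> 0" by (simp add: mult_nonpos_nonneg)
    with False show ?thesis by (smt (verit) of_nat_0_le_iff)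
  qed
  then show ?thesis by (simp; linarith)
qed

lemma burning_cong: "(\<And>i. i < t \<Longrightarrow> c i = c' i) \<Longrightarrow> burning D c t j = burning D c' t j"
  by (induction t) auto

lemma feasible_iff_burning:
  assumes "\<And>i j. i < t \<Longrightarrow> j < m \<Longrightarrow> D i j > 0"
  shows "feasible m D t V \<longleftrightarrow> (\<exists>c. (\<forall>i<t. c i < m) \<and> (\<forall>j<m. burning D c t j \<le> int (V j)))"
  using assms
proof (induction t arbitrary: V)
  case 0
  then show ?case by auto
next
  case (Suc t)
  have "feasible m D (Suc t) V \<longleftrightarrow> (\<exists>a<m. \<exists>c. (\<forall>i<t. c i < m) \<and>
      (\<forall>j<m. burning D c t j * int (D t j) - of_bool (a = j) \<le> int (V j)))"
    using Suc by (simp add: le_div_iff_mult_le_add del: of_bool_eq)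
  also have "\<dots> \<longleftrightarrow> (\<exists>c. (\<forall>i<Suc t. c i < m) \<and> (\<forall>j<m. burning D c (Suc t) j \<le> int (V j)))"
    (is "?L \<longleftrightarrow> ?R")
  proof
    assume ?L
    then obtain a c where ac: "a < m" "\<And>i. i < t \<Longrightarrow> c i < m"
      "\<And>j. j < m \<Longrightarrow> burning D c t j * int (D t j) - of_bool (a = j) \<le> int (V j)" by blast
    have "burning D (c(t := a)) t j = burning D c t j" for j by (rule burning_cong) simp
    with ac show ?R by (intro exI[of _ "c(t := a)"]) (auto simp: less_Suc_eq)
  next
    assume ?R
    then show ?L by (metis burning.simps(2) less_Suc_eq)
  qed
  finally show ?case .
qed

text \<open>
  With fewer steps than trees some tree never gets a firefighter, and its number stays at least 1.
\<close>

lemma not_feasible_zero: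
  assumes "\<And>i j. i < t \<Longrightarrow> j < m \<Longrightarrow> D i j > 0" "t < m"
  shows "\<not> feasible m D t (\<lambda>_. 0)"
proof
  assume "feasible m D t (\<lambda>_. 0)"
  then obtain c where c: "\<And>j. j < m \<Longrightarrow> burning D c t j \<le> 0"
    using feasible_iff_burning[OF assms(1)] by auto
  have "card (c ` {..<t}) < card {..<m}" using card_image_le[of "{..<t}" c] assms(2) by simp
  then have "\<not> {..<m} \<subseteq> c ` {..<t}" by (meson card_mono finite_imageI finite_lessThan not_le)
  then obtain j where j: "j < m" "\<And>i. i < t \<Longrightarrow> c i \<noteq> j" by blast
  have "i \<le> t \<Longrightarrow> burning D c i j \<ge> 1" for i
  proof (induction i)
    case (Suc i)
    then have "burning D c i j \<ge> 1" "int (D i j) \<ge> 1" using assms(1)[of i j] j by auto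
    then have "1 * 1 \<le> burning D c i j * int (D i j)" by (intro mult_mono) auto
    then show ?case using j(2)[of i] Suc.prems by simp
  qed simp
  with c[of j] j show False by fastforce
qed

lemma can_save_iff_feasible:
  assumes "m \<ge> 1" "k \<ge> 1" "\<And>i j. i < n \<Longrightarrow> j < m \<Longrightarrow> d i j \<ge> 1"
  shows "can_save_all_leaves m n k d \<longleftrightarrow> feasible m (factor k d) (k * n) (\<lambda>_. 0)"
proof -
  have "factor k d i j > 0" if "i < k * n" "j < m" for i j
    using that assms(3)[of "i div k" j]
    by (auto simp: factor_def less_mult_imp_div_less mult.commute Suc_le_eq)
  then have "feasible m (factor k d) (k * n) (\<lambda>_. 0) \<longleftrightarrow>
      (\<exists>c. (\<forall>i<k * n. c i < m) \<and> (\<forall>j<m. burning (factor k d) c (k * n) j \<le> 0))"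
    by (subst feasible_iff_burning) auto
  then show ?thesis
    using burning_le_zero_if_can_save[OF assms(2,1)] can_save_if_burning_le_zero[OF assms(2)]
    by (metis mult.commute)
qed

section \<open>Weakest preconditions with cost\<close>

text \<open>
  The postcondition also speaks of the number of steps, so total correctness and the running time are
  proved together, and all loop-free programs are handled by rewriting.
\<close>

definition wp :: "com \<Rightarrow> mem \<Rightarrow> (nat \<Rightarrow> mem \<Rightarrow> bool) \<Rightarrow> bool" where
  "wp c s Q \<longleftrightarrow> (\<exists>t s'. exec c s t s' \<and> Q t s')"

lemma wp_mono: "wp c s Q \<Longrightarrow> (\<And>t s'. Q t s' \<Longrightarrow> Q' t s') \<Longrightarrow> wp c s Q'"
  unfolding wp_def by blast

lemma wp_transfer:
  "wp c s Q \<Longrightarrow> s' = s \<Longrightarrow> (\<And>t r. Q t r \<Longrightarrow> Q' t r) \<Longrightarrow> wp c s' Q'"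
  by (simp add: wp_mono)

lemma wp_Skip: "wp Skip s Q \<longleftrightarrow> Q 1 s"
  unfolding wp_def by (blast intro: exec.Skip dest: exec_deterministic[OF exec.Skip])

lemma wp_Assign: "wp (Assign x a e) s Q \<longleftrightarrow>
    Q (acost a + acost e + 1) (s(x := (s x)(aval a s := aval e s)))"
  unfolding wp_def by (blast intro: exec.Assign dest: exec_deterministic[OF exec.Assign])

lemma wp_Seq: "wp (Seq c1 c2) s Q \<longleftrightarrow>
    wp c1 s (\<lambda>t1 s1. wp c2 s1 (\<lambda>t2 s2. Q (t1 + t2) s2))"
  unfolding wp_def
proof
  assume "\<exists>t s'. exec (Seq c1 c2) s t s' \<and> Q t s'"
  then obtain t s' where "exec (Seq c1 c2) s t s'" "Q t s'" by blast
  then show "\<exists>t1 s1. exec c1 s t1 s1 \<and> (\<exists>t2 s2. exec c2 s1 t2 s2 \<and> Q (t1 + t2) s2)"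
    by (cases rule: exec.cases) auto
qed (blast intro: exec.Seq)

lemma wp_If: "wp (If b c1 c2) s Q \<longleftrightarrow>
    wp (if bval b s then c1 else c2) s (\<lambda>t s'. Q (bcost b + 1 + t) s')"
  unfolding wp_def
proof
  assume "\<exists>t s'. exec (If b c1 c2) s t s' \<and> Q t s'"
  then obtain t s' where "exec (If b c1 c2) s t s'" "Q t s'" by blast
  then show "\<exists>t s'. exec (if bval b s then c1 else c2) s t s' \<and> Q (bcost b + 1 + t) s'"
    by (cases rule: exec.cases) auto
qed (cases "bval b s"; force dest: exec.IfTrue exec.IfFalse)

abbreviation Var :: "name \<Rightarrow> aexp" where "Var x \<equiv> Cell x (Const 0)"

abbreviation Store :: "name \<Rightarrow> aexp \<Rightarrow> com" where "Store x e \<equiv> Assign x (Const 0) e"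

definition Select :: "name \<Rightarrow> bexp \<Rightarrow> aexp \<Rightarrow> aexp \<Rightarrow> com" where
  "Select x b e1 e2 = If b (Store x e1) (Store x e2)"

lemma wp_Select: "wp (Select x b e1 e2) s Q \<longleftrightarrow>
    Q (bcost b + 3 + (if bval b s then acost e1 else acost e2))
      (s(x := (s x)(0 := if bval b s then aval e1 s else aval e2 s)))"
  by (auto simp: Select_def wp_If wp_Assign eval_nat_numeral)

definition For :: "name \<Rightarrow> aexp \<Rightarrow> com \<Rightarrow> com" where
  "For x e c = Seq (Store x (Const 0))
     (While (Less (Var x) e) (Seq c (Store x (Arith Plus (Var x) (Const 1)))))"

text \<open>
  In the cost bound 10 accounts for the increment of the counter, which costs 6, and for the loop test
  apart from its bound \<open>e\<close>, which costs 4.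
\<close>

lemma wp_For:
  assumes init: "I 0 (s(x := (s x)(0 := 0)))"
    and step: "\<And>i s. i < n \<Longrightarrow> I i s \<Longrightarrow> s x 0 = int i \<Longrightarrow>
      wp c s (\<lambda>t s'. t \<le> T \<and> s' x 0 = int i \<and> I (Suc i) (s'(x := (s' x)(0 := int (Suc i)))))"
    and bound: "\<And>i s. i \<le> n \<Longrightarrow> I i s \<Longrightarrow> aval e s = int n"
  shows "wp (For x e c) s (\<lambda>t s'. t \<le> n * (T + acost e + 10) + acost e + 7 \<and> s' x 0 = int n \<and> I n s')"
proof -
  let ?W = "While (Less (Var x) e) (Seq c (Store x (Arith Plus (Var x) (Const 1))))"
  have "wp ?W s (\<lambda>t s'. t \<le> l * (T + acost e + 10) + acost e + 4 \<and> s' x 0 = int n \<and> I n s')"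
    if "l \<le> n" "I (n - l) s" "s x 0 = int (n - l)" for l s
    using that
  proof (induction l arbitrary: s)
    case 0
    then have "exec ?W s (bcost (Less (Var x) e) + 1) s"
      using bound[of n s] by (intro exec.WhileFalse) simp
    with 0 show ?case unfolding wp_def by (intro exI conjI) auto
  next
    case (Suc l)
    let ?i = "n - Suc l"
    from step[of ?i s] Suc.prems obtain t1 s1 where s1: "exec c s t1 s1" "t1 \<le> T" "s1 x 0 = int ?i"
      "I (Suc ?i) (s1(x := (s1 x)(0 := int (Suc ?i))))"
      unfolding wp_def by auto
    let ?s2 = "s1(x := (s1 x)(0 := int (Suc ?i)))"
    have "exec (Store x (Arith Plus (Var x) (Const 1))) s1 6 ?s2"
      using exec.Assign[of x "Const 0" "Arith Plus (Var x) (Const 1)" s1] s1(3)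
      by (simp add: add.commute eval_nat_numeral)
    with s1(1) have body: "exec (Seq c (Store x (Arith Plus (Var x) (Const 1)))) s (t1 + 6) ?s2"
      by (rule exec.Seq)
    have eq: "Suc ?i = n - l" using Suc.prems by simp
    have "wp ?W ?s2 (\<lambda>t s'. t \<le> l * (T + acost e + 10) + acost e + 4 \<and> s' x 0 = int n \<and> I n s')"
    proof (rule Suc.IH)
      show "l \<le> n" using Suc.prems by simp
      show "I (n - l) ?s2" using s1(4) unfolding eq by assumption
      show "?s2 x 0 = int (n - l)" unfolding eq by simp
    qed
    then obtain t2 s3 where s3: "exec ?W ?s2 t2 s3" "t2 \<le> l * (T + acost e + 10) + acost e + 4"
      "s3 x 0 = int n" "I n s3" unfolding wp_def by auto
    have "bval (Less (Var x) e) s" using bound[of ?i s] Suc.prems by simp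
    from exec.WhileTrue[OF this body s3(1)] s1(2) s3(2-) show ?case
      unfolding wp_def by (intro exI conjI) auto
  qed
  from this[of n "s(x := (s x)(0 := 0))"] init show ?thesis
    by (auto simp: For_def wp_Seq wp_Assign elim: wp_mono)
qed

lemma wp_ForI:
  assumes "I 0 (s(x := (s x)(0 := 0)))"
    and "\<And>i s. i < n \<Longrightarrow> I i s \<Longrightarrow> s x 0 = int i \<Longrightarrow>
      wp c s (\<lambda>t s'. t \<le> T \<and> s' x 0 = int i \<and> I (Suc i) (s'(x := (s' x)(0 := int (Suc i)))))"
    and "\<And>i s. i \<le> n \<Longrightarrow> I i s \<Longrightarrow> aval e s = int n"
    and "\<And>t s'. t \<le> n * (T + acost e + 10) + acost e + 7 \<Longrightarrow> I n s' \<Longrightarrow> Q t s'"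
  shows "wp (For x e c) s Q"
  by (rule wp_mono[OF wp_For[where I = I and n = n and T = T]]) (use assms in blast)+

section \<open>The dynamic program\<close>

definition digit :: "nat \<Rightarrow> nat \<Rightarrow> nat \<Rightarrow> nat" where
  "digit B x r = x div B ^ r mod B"

lemma digits_of_sum:
  assumes "\<And>r. r < M \<Longrightarrow> W r < B"
  shows "(\<Sum>r<M. W r * B ^ r) < B ^ M" and "r < M \<Longrightarrow> digit B (\<Sum>r<M. W r * B ^ r) r = W r"
proof -
  have "(\<Sum>r<M. W r * B ^ r) < B ^ M \<and> (\<forall>r<M. digit B (\<Sum>r<M. W r * B ^ r) r = W r)"
    using assms
  proof (induction M arbitrary: W)
    case (Suc M)
    let ?S = "\<Sum>r<M. W (Suc r) * B ^ r"
    have IH: "?S < B ^ M" "\<And>r. r < M \<Longrightarrow> digit B ?S r = W (Suc r)"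
      using Suc.IH[of "\<lambda>r. W (Suc r)"] Suc.prems by auto
    have W0: "W 0 < B" using Suc.prems by simp
    have S: "(\<Sum>r<Suc M. W r * B ^ r) = W 0 + B * ?S"
      by (subst sum.lessThan_Suc_shift) (simp add: sum_distrib_left mult_ac)
    have "B * Suc ?S \<le> B * B ^ M" using IH(1) by (intro mult_left_mono) auto
    then have "W 0 + B * ?S < B ^ Suc M" using W0 by simp
    moreover have "digit B (W 0 + B * ?S) r = W r" if "r < Suc M" for r
    proof (cases r)
      case 0
      then show ?thesis using W0 by (simp add: digit_def)
    next
      case (Suc r')
      then have "digit B (W 0 + B * ?S) r = digit B ?S r'"
        using W0 by (simp add: digit_def div_mult2_eq)
      with IH(2)[of r'] Suc that show ?thesis by simp
    qed
    ultimately show ?case unfolding S by blast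
  qed simp
  then show "(\<Sum>r<M. W r * B ^ r) < B ^ M" "r < M \<Longrightarrow> digit B (\<Sum>r<M. W r * B ^ r) r = W r"
    by blast+
qed

text \<open>
  The cells that the loops only read.  Scalars besides the input are \<open>K = k * n\<close>, the base \<open>B = K + 1\<close>
  in which the thresholds of the first \<open>m - 1\<close> trees are coded, and the number \<open>N\<close> of codes.
\<close>

definition env :: "nat \<Rightarrow> nat \<Rightarrow> nat \<Rightarrow> (nat \<Rightarrow> nat \<Rightarrow> nat) \<Rightarrow> mem \<Rightarrow> bool" where
  "env m n k d s \<longleftrightarrow>
     s ''m'' 0 = int m \<and> s ''k'' 0 = int k \<and> s ''K'' 0 = int (k * n) \<and>
     s ''B'' 0 = int (k * n + 1) \<and> s ''N'' 0 = int ((k * n + 1) ^ (m - 1)) \<and>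
     (\<forall>i<n. \<forall>j<m. s ''d'' (int (i * m + j)) = int (d i j))"

lemma env_cong:
  "env m n k d s \<Longrightarrow> (\<And>a. a \<in> {''m'', ''k'', ''K'', ''B'', ''N'', ''d''} \<Longrightarrow> s' a = s a) \<Longrightarrow> env m n k d s'"
  by (simp add: env_def)

definition pred_m :: aexp where "pred_m = Arith Minus (Var ''m'') (Const 1)"

definition load_factor :: "aexp \<Rightarrow> com" where
  "load_factor j = Select ''w'' (Equal (Arith Mod (Var ''t'') (Var ''k'')) (Const 0))
     (Cell ''d'' (Arith Plus (Arith Times (Arith Div (Var ''t'') (Var ''k'')) (Var ''m'')) j))
     (Const 1)"

lemma wp_load_factor:
  assumes "env m n k d s" "s ''t'' 0 = int t" "t < k * n" "aval j s = int r" "r < m"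
    and Q: "\<And>u. u \<le> acost j + 25 \<Longrightarrow> Q u (s(''w'' := (s ''w'')(0 := int (factor k d t r))))"
  shows "wp (load_factor j) s Q"
proof -
  have "t div k < n" using assms(3) by (simp add: less_mult_imp_div_less mult.commute)
  then have "s ''d'' (int (t div k * m + r)) = int (d (t div k) r)"
    using assms by (simp add: env_def)
  moreover have "s ''k'' 0 = int k" "s ''m'' 0 = int m" using assms by (simp_all add: env_def)
  ultimately show ?thesis
    using assms(2,4) Q[of "acost j + 20"] Q[of 11]
    by (cases "t mod k = 0") (simp_all add: add.commute load_factor_def wp_Select factor_def flip: zmod_int zdiv_int)
qed

text \<open>
  From the code \<open>s\<close> of thresholds after step \<open>t\<close> the scan finds the code \<open>z\<close> of the thresholds before it
  when Tree \<open>c\<close> gets the firefighter.  It also multiplies these thresholds to \<open>y\<close>: before the first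
  step one vertex burns in each tree, so the thresholds hold at that time iff none of them is 0.
\<close>

definition scan :: com where
  "scan = Seq (Store ''q'' (Var ''s'')) (Seq (Store ''p'' (Const 1)) (Seq (Store ''z'' (Const 0))
    (Seq (Store ''y'' (Const 1)) (For ''r'' pred_m
      (Seq (load_factor (Var ''r''))
      (Seq (Select ''w'' (Equal (Var ''r'') (Var ''c''))
             (Arith Div (Arith Plus (Arith Mod (Var ''q'') (Var ''B'')) (Const 1)) (Var ''w''))
             (Arith Div (Arith Mod (Var ''q'') (Var ''B'')) (Var ''w'')))
      (Seq (Store ''z'' (Arith Plus (Var ''z'') (Arith Times (Var ''w'') (Var ''p''))))
      (Seq (Store ''y'' (Arith Times (Var ''y'') (Var ''w'')))
      (Seq (Store ''p'' (Arith Times (Var ''p'') (Var ''B'')))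
           (Store ''q'' (Arith Div (Var ''q'') (Var ''B''))))))))))))"

lemma wp_scan:
  assumes env: "env m n k d s0" and t: "s0 ''t'' 0 = int t" "t < k * n"
    and s: "s0 ''s'' 0 = int x" and c: "s0 ''c'' 0 = int c" and m: "m \<ge> 1"
    and B: "B = k * n + 1"
    and W: "W = (\<lambda>r. (digit B x r + of_bool (c = r)) div factor k d t r)"
  shows "wp scan s0 (\<lambda>u s. u \<le> 200 * m \<and>
    s ''z'' 0 = int (\<Sum>r<m - 1. W r * B ^ r) \<and> s ''y'' 0 = int (\<Prod>r<m - 1. W r) \<and>
    (\<forall>a. a \<notin> {''q'', ''p'', ''z'', ''y'', ''w'', ''r''} \<longrightarrow> s a = s0 a))"
proof -
  define I where "I i s \<longleftrightarrow> s ''q'' 0 = int (x div B ^ i) \<and> s ''p'' 0 = int (B ^ i) \<and>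
    s ''z'' 0 = int (\<Sum>r<i. W r * B ^ r) \<and> s ''y'' 0 = int (\<Prod>r<i. W r) \<and>
    (\<forall>a. a \<notin> {''q'', ''p'', ''z'', ''y'', ''w'', ''r''} \<longrightarrow> s a = s0 a)" for i and s :: mem
  have env_I: "env m n k d s" "s ''t'' 0 = int t" "s ''c'' 0 = int c" "s ''B'' 0 = int B" "s ''m'' 0 = int m"
    if "I i s" for i s
  proof -
    have "s a = s0 a" if "a \<notin> {''q'', ''p'', ''z'', ''y'', ''w'', ''r''}" for a
      using \<open>I i s\<close> that unfolding I_def by blast
    then show "env m n k d s" "s ''t'' 0 = int t" "s ''c'' 0 = int c" 
      "s ''B'' 0 = int B" "s ''m'' 0 = int m"
      using env t c B by (auto simp: env_def)
  qed
  show ?thesis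
    unfolding scan_def wp_Seq wp_Assign
  proof (rule wp_ForI[where I = I and n = "m - 1" and T = 100], goal_cases)
    case 1
    show ?case using s by (simp add: I_def)
  next
    case (2 i s)
    note E = env_I[OF 2(2)]
    have digit: "int (x div B ^ i) mod int B = int (digit B x i)"
      by (simp add: digit_def zmod_int)
    have w1: "(int (x div B ^ c) mod int B + 1) div int (factor k d t c) = int (W c)"
      by (simp add: W digit_def zdiv_int zmod_int add.commute)
    have w2: "int (x div B ^ i) mod int B div int (factor k d t i) = int (W i)" if "i \<noteq> c"
      unfolding digit using that by (simp add: W zdiv_int)
    have p: "int (x div B ^ i) div int B = int (x div B ^ Suc i)"
      by (simp only: power_Suc2 div_mult2_eq of_nat_div)
    have I: "s ''q'' 0 = int (x div B ^ i)" "s ''p'' 0 = int (B ^ i)"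
      "s ''z'' 0 = int (\<Sum>r<i. W r * B ^ r)" "s ''y'' 0 = int (\<Prod>r<i. W r)"
      "\<And>a. a \<notin> {''q'', ''p'', ''z'', ''y'', ''w'', ''r''} \<Longrightarrow> s a = s0 a"
      using 2(2) by (auto simp only: I_def)
    show ?case
      unfolding wp_Seq
    proof (rule wp_load_factor[OF E(1,2) t(2), where r = i], goal_cases)
      case (3 u)
      then show ?case
        using 2(3) E(3,4) I(1-4)
        by (simp add: wp_Select wp_Assign I_def I(5) w1 w2 p del: of_nat_div of_nat_sum of_nat_prod)
    qed (use 2 in auto)
  next
    case (3 i s)
    then show ?case using env_I[OF 3(2)] m by (simp add: pred_m_def of_nat_diff)
  next
    case (4 u s)
    then show ?case using m by (auto simp: I_def pred_m_def algebra_simps)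
  qed
qed

definition thresholds :: "nat \<Rightarrow> nat \<Rightarrow> nat \<Rightarrow> nat \<Rightarrow> nat \<Rightarrow> nat" where
  "thresholds B M x v = (\<lambda>j. if j < M then digit B x j else v)"

text \<open>
  A table entry is asserted to be right only for thresholds that leave room for the \<open>t\<close> increments of
  earlier steps.  Within these limits adding 1 never overflows a digit, and the remaining
  cells may hold anything, so the program needs no range checks.
\<close>

definition in_box :: "nat \<Rightarrow> nat \<Rightarrow> nat \<Rightarrow> nat \<Rightarrow> bool" where
  "in_box K M t x \<longleftrightarrow> (\<forall>r<M. digit (K + 1) x r + t \<le> K)"

text \<open>
  An entry represents the least threshold \<open>v\<close> of the last tree that can be met.  Any number above the
  limits stands for the case that none within them can be met, and any number up to 0 for \<open>v = 0\<close>.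
\<close>

definition correct_entry :: "nat \<Rightarrow> nat \<Rightarrow> (nat \<Rightarrow> nat \<Rightarrow> nat) \<Rightarrow> nat \<Rightarrow> nat \<Rightarrow> int \<Rightarrow> bool" where
  "correct_entry K m D t x e \<longleftrightarrow> (in_box K (m - 1) t x \<longrightarrow>
     (\<forall>v. v + t \<le> K \<longrightarrow> (e \<le> int v \<longleftrightarrow> feasible m D t (thresholds (K + 1) (m - 1) x v))))"

text \<open>
  The recurrence of the table.  At \<open>t = 0\<close> no table is consulted: the threshold of the last tree must
  be at least 1, and \<open>B = K + 1\<close> serves as infinity if another threshold is 0.
\<close>

lemma candidate_correct:
  assumes m: "m \<ge> 1" and D: "\<And>j. j < m \<Longrightarrow> D t j > 0" and B: "B = K + 1"
    and x: "in_box K (m - 1) (Suc t) x" and v: "v + Suc t \<le> K"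
    and W: "W = (\<lambda>r. (digit B x r + of_bool (c = r)) div D t r)"
    and h: "\<And>y. t > 0 \<Longrightarrow> y < B ^ (m - 1) \<Longrightarrow> correct_entry K m D t y (h y)"
    and u: "u = (if t = 0 then if (\<Prod>r<m - 1. W r) = 0 then int B else 1
                 else h (\<Sum>r<m - 1. W r * B ^ r))"
  shows "u * int (D t (m - 1)) - of_bool (c = m - 1) \<le> int v \<longleftrightarrow>
    feasible m D t (\<lambda>j. (thresholds B (m - 1) x v j + of_bool (c = j)) div D t j)"
proof -
  let ?Z = "\<Sum>r<m - 1. W r * B ^ r"
  let ?V = "\<lambda>j. (thresholds B (m - 1) x v j + of_bool (c = j)) div D t j"
  define v' where "v' = (v + of_bool (c = m - 1)) div D t (m - 1)"
  have "v' \<le> v + 1" unfolding v'_def by (rule order_trans[OF div_le_dividend]) simp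
  then have v': "v' + t \<le> K" using v by simp
  have W_le: "W r + t \<le> K" if "r < m - 1" for r
  proof -
    have "W r \<le> digit B x r + 1" unfolding W by (rule order_trans[OF div_le_dividend]) simp
    then show ?thesis using x that by (fastforce simp: in_box_def B)
  qed
  then have W_less: "W r < B" if "r < m - 1" for r using that by (fastforce simp: B)
  have V: "?V j = (if j < m - 1 then W j else v')" if "j < m" for j
  proof (cases "j < m - 1")
    case False
    then have "j = m - 1" using that by simp
    then show ?thesis by (simp add: thresholds_def v'_def)
  qed (simp add: thresholds_def W)
  have "u \<le> int v' \<longleftrightarrow> feasible m D t ?V"
  proof (cases "t = 0")
    case True
    have "feasible m D t ?V \<longleftrightarrow> (\<forall>j<m. 1 \<le> (if j < m - 1 then W j else v'))"
      using V True by simp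
    also have "\<dots> \<longleftrightarrow> (\<forall>j<m - 1. W j \<noteq> 0) \<and> 1 \<le> v'"
      using m by (cases m) (auto simp: All_less_Suc Suc_le_eq)
    also have "\<dots> \<longleftrightarrow> u \<le> int v'"
      using True v' by (auto simp: u B)
    finally show ?thesis ..
  next
    case False
    note digits = digits_of_sum[of "m - 1" W B, OF W_less]
    have "correct_entry K m D t ?Z (h ?Z)" using False digits(1) by (intro h) auto
    moreover have "in_box K (m - 1) t ?Z"
      using W_le digits(2) by (simp add: in_box_def B)
    ultimately have "h ?Z \<le> int v' \<longleftrightarrow> feasible m D t (thresholds B (m - 1) ?Z v')"
      using v' by (simp add: correct_entry_def B)
    also have "\<dots> \<longleftrightarrow> feasible m D t ?V"
    proof (rule feasible_cong)
      fix j assume "j < m"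
      show "thresholds B (m - 1) ?Z v' j = ?V j"
        unfolding V[OF \<open>j < m\<close>] by (simp add: thresholds_def digits(2)[simplified])
    qed
    finally show ?thesis using False by (simp add: u)
  qed
  moreover have "D t (m - 1) > 0" using m D by simp
  ultimately show ?thesis
    by (simp only: le_div_iff_mult_le_add v'_def)
qed

definition trial :: com where
  "trial = Seq scan
    (Seq (Select ''v'' (Equal (Var ''y'') (Const 0)) (Var ''B'') (Const 1))
    (Seq (Select ''v'' (Equal (Var ''t'') (Const 0)) (Var ''v'')
           (Cell ''h'' (Arith Plus (Arith Times (Var ''t'') (Var ''N'')) (Var ''z''))))
    (Seq (load_factor pred_m)
    (Seq (Select ''v'' (Equal (Var ''c'') pred_m)
           (Arith Minus (Arith Times (Var ''v'') (Var ''w'')) (Const 1))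
           (Arith Times (Var ''v'') (Var ''w'')))
         (Select ''b'' (Less (Var ''v'') (Var ''b'')) (Var ''v'') (Var ''b''))))))"

abbreviation trial_vars :: "name set" where
  "trial_vars \<equiv> {''q'', ''p'', ''z'', ''y'', ''w'', ''r'', ''v'', ''b''}"

lemma wp_trial:
  assumes env: "env m n k d s0" and t: "s0 ''t'' 0 = int t" "t < k * n"
    and s: "s0 ''s'' 0 = int x" and c: "s0 ''c'' 0 = int c" and m: "m \<ge> 1"
    and K: "K = k * n" and B: "B = K + 1" and D: "D = factor k d" "\<And>j. j < m \<Longrightarrow> D t j > 0"
    and h: "\<And>y. t > 0 \<Longrightarrow> y < B ^ (m - 1) \<Longrightarrow> correct_entry K m D t y (s0 ''h'' (int (t * B ^ (m - 1) + y)))"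
  shows "wp trial s0 (\<lambda>u s. u \<le> 300 * m \<and>
    (\<exists>e. s ''b'' 0 = min (s0 ''b'' 0) e \<and>
      (in_box K (m - 1) (Suc t) x \<longrightarrow> (\<forall>v. v + Suc t \<le> K \<longrightarrow> (e \<le> int v \<longleftrightarrow>
        feasible m D t (\<lambda>j. (thresholds B (m - 1) x v j + of_bool (c = j)) div D t j))))) \<and>
    (\<forall>a. a \<notin> trial_vars \<longrightarrow> s a = s0 a))"
proof -
  define W where "W = (\<lambda>r. (digit B x r + of_bool (c = r)) div D t r)"
  define h' where "h' y = s0 ''h'' (int (t * B ^ (m - 1) + y))" for y
  define u where "u = (if t = 0 then if (\<Prod>r<m - 1. W r) = 0 then int B else 1
                 else h' (\<Sum>r<m - 1. W r * B ^ r))"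
  define e where "e = u * int (D t (m - 1)) - of_bool (c = m - 1)"
  have "B = k * n + 1" using B K by simp
  note scan = wp_scan[OF env t s c m this W_def[unfolded D(1)]]
  show ?thesis
    unfolding trial_def
  proof (rule wp_Seq[THEN iffD2], rule wp_mono[OF scan], goal_cases)
    case (1 tm s)
    then have z: "s ''z'' 0 = int (\<Sum>r<m - 1. W r * B ^ r)" and y: "s ''y'' 0 = int (\<Prod>r<m - 1. W r)"
      and tm: "tm \<le> 200 * m"
      and fr: "\<And>a. a \<notin> {''q'', ''p'', ''z'', ''y'', ''w'', ''r''} \<Longrightarrow> s a = s0 a" by auto
    have env1: "env m n k d s" by (rule env_cong[OF env]) (auto intro!: fr)
    have vals: "s ''t'' 0 = int t" "s ''c'' 0 = int c" "s ''N'' 0 = int (B ^ (m - 1))"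
      "s ''B'' 0 = int B" "s ''m'' 0 = int m"
      using env1 t c B K by (simp_all add: fr env_def)
    define s1 where "s1 = s(''v'' := (s ''v'')(0 := if s ''y'' 0 = 0 then int B else 1))"
    define s2 where "s2 = s1(''v'' := (s1 ''v'')(0 := u))"
    have s2: "s2 = s1(''v'' := (s1 ''v'')(0 := if t = 0 then s1 ''v'' 0 else s1 ''h'' (int (t * B ^ (m - 1)) + s1 ''z'' 0)))"
      unfolding s2_def u_def using y z by (simp add: s1_def fr h'_def)
    have env2: "env m n k d s2" by (rule env_cong[OF env1]) (auto simp: s2_def s1_def)
    let ?rest = "Seq (load_factor pred_m)
    (Seq (Select ''v'' (Equal (Var ''c'') pred_m)
           (Arith Minus (Arith Times (Var ''v'') (Var ''w'')) (Const 1))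
           (Arith Times (Var ''v'') (Var ''w'')))
         (Select ''b'' (Less (Var ''v'') (Var ''b'')) (Var ''v'') (Var ''b'')))"
    have rest: "wp ?rest s2 (\<lambda>t3 s3. t3 \<le> 60 \<and> s3 ''b'' 0 = min (s0 ''b'' 0) e \<and>
        (\<forall>a. a \<notin> trial_vars \<longrightarrow> s3 a = s0 a))"
      unfolding wp_Seq
    proof (rule wp_load_factor[OF env2 _ t(2), where r = "m - 1"], goal_cases)
      case 1
      show ?case using vals by (simp add: s2_def s1_def)
    next
      case 2
      show ?case using vals m by (simp add: s2_def s1_def pred_m_def of_nat_diff)
    next
      case 3
      show ?case using m by simp
    next
      case (4 t3)
      have "int c = int m - 1 \<longleftrightarrow> c = m - 1" using m by auto
      then show ?case
        using vals 4 by (simp add: wp_Select s2_def s1_def pred_m_def fr e_def D(1) min_def)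
    qed
    show ?case
    proof (rule wp_Seq[THEN iffD2], rule wp_Select[THEN iffD2], rule wp_Seq[THEN iffD2],
        rule wp_Select[THEN iffD2], rule wp_transfer[OF rest], goal_cases)
      case 1
      show ?case using vals by (simp add: s2 s1_def add.commute)
    next
      case (2 t3 s3)
      have "in_box K (m - 1) (Suc t) x \<longrightarrow> (\<forall>v. v + Suc t \<le> K \<longrightarrow> (e \<le> int v \<longleftrightarrow>
        feasible m D t (\<lambda>j. (thresholds B (m - 1) x v j + of_bool (c = j)) div D t j)))"
        unfolding e_def
      proof (intro impI allI, rule candidate_correct[where h = h' and K = K and W = W], goal_cases)
        case (7 v y)
        then show ?case using h by (simp add: h'_def)
      qed (simp_all add: m[unfolded One_nat_def] D(2) B W_def u_def)
      moreover have "tm + (bcost (Equal (Var ''y'') (Const 0)) + 3 + 2 + (30 + t3)) \<le> 300 * m"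
        using tm conjunct1[OF 2] m by simp
      ultimately show ?case using 2 m tm by (intro conjI exI[of _ e]) auto
    qed
  qed
qed

text \<open>
  The minimum over \<open>c\<close> starts from \<open>B\<close>, which exceeds every threshold within the limits.
\<close>

definition fill_cell :: com where
  "fill_cell = Seq (Store ''b'' (Var ''B''))
    (Seq (For ''c'' (Var ''m'') trial)
      (Assign ''h''
        (Arith Plus (Arith Times (Arith Plus (Var ''t'') (Const 1)) (Var ''N'')) (Var ''s''))
        (Var ''b'')))"

lemma wp_fill_cell:
  assumes env: "env m n k d s0" and t: "s0 ''t'' 0 = int t" "t < k * n"
    and s: "s0 ''s'' 0 = int x" and m: "m \<ge> 1"
    and K: "K = k * n" and B: "B = K + 1" and D: "D = factor k d" "\<And>j. j < m \<Longrightarrow> D t j > 0"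
    and h: "\<And>y. t > 0 \<Longrightarrow> y < B ^ (m - 1) \<Longrightarrow> correct_entry K m D t y (s0 ''h'' (int (t * B ^ (m - 1) + y)))"
  shows "wp fill_cell s0 (\<lambda>u s. u \<le> 400 * (m * m) \<and>
    (\<exists>e. correct_entry K m D (Suc t) x e \<and> s ''h'' = (s0 ''h'')(int (Suc t * B ^ (m - 1) + x) := e)) \<and>
    (\<forall>a. a \<notin> insert ''h'' (insert ''c'' trial_vars) \<longrightarrow> s a = s0 a))"
proof -
  define P where "P c v \<longleftrightarrow>
    feasible m D t (\<lambda>j. (thresholds B (m - 1) x v j + of_bool (c = j)) div D t j)" for c v
  define I where "I i s \<longleftrightarrow> (\<forall>a. a \<notin> insert ''c'' trial_vars \<longrightarrow> s a = s0 a) \<and>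
    (in_box K (m - 1) (Suc t) x \<longrightarrow> (\<forall>v. v + Suc t \<le> K \<longrightarrow>
      (s ''b'' 0 \<le> int v \<longleftrightarrow> (\<exists>c<i. P c v))))"
    for i and s :: mem
  have I: "env m n k d s" "s ''t'' 0 = int t" "s ''s'' 0 = int x" "s ''m'' 0 = int m"
      "s ''h'' = s0 ''h''" "s ''N'' 0 = int (B ^ (m - 1))" "\<And>a. a \<notin> insert ''c'' trial_vars \<Longrightarrow> s a = s0 a"
    if "I i s" for i s
  proof -
    show fr: "\<And>a. a \<notin> insert ''c'' trial_vars \<Longrightarrow> s a = s0 a" using that unfolding I_def by blast
    show E: "env m n k d s" by (rule env_cong[OF env]) (auto intro!: fr)
    show "s ''t'' 0 = int t" "s ''s'' 0 = int x" "s ''m'' 0 = int m" "s ''h'' = s0 ''h''"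
      "s ''N'' 0 = int (B ^ (m - 1))"
      using t s E B K by (simp_all add: fr env_def)
  qed
  have B0: "s0 ''B'' 0 = int (K + 1)" using env K by (simp add: env_def)
  show ?thesis
    unfolding fill_cell_def wp_Seq
  proof (rule wp_Assign[THEN iffD2], rule wp_ForI[where I = I and n = m and T = "300 * m"], goal_cases)
    case 1
    show ?case using B0 by (simp add: I_def)
  next
    case (2 i s)
    note E = I[OF 2(2)]
    show ?case
    proof (rule wp_mono[OF wp_trial[OF E(1,2) t(2) E(3) 2(3) m K B D]], goal_cases)
      case (2 y)
      then show ?case using h E(5) by simp
    next
      case (3 u s')
      note post = 3[THEN conjunct1] 3[THEN conjunct2, THEN conjunct1]
        3[THEN conjunct2, THEN conjunct2, rule_format]
      from post(2) obtain e where e: "s' ''b'' 0 = min (s ''b'' 0) e"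
        "in_box K (m - 1) (Suc t) x \<longrightarrow> (\<forall>v. v + Suc t \<le> K \<longrightarrow> (e \<le> int v \<longleftrightarrow> P i v))"
        unfolding P_def by (elim exE conjE)
      have "s' ''c'' 0 = int i" using post(3)[of "''c''"] \<open>s ''c'' 0 = int i\<close> by simp
      moreover have "I (Suc i) (s'(''c'' := (s' ''c'')(0 := int (Suc i))))"
        unfolding I_def
      proof (intro conjI allI impI)
        fix a assume "a \<notin> insert ''c'' trial_vars"
        then show "(s'(''c'' := (s' ''c'')(0 := int (Suc i)))) a = s0 a"
          using post(3)[of a] E(7)[of a] by simp
      next
        fix v assume "in_box K (m - 1) (Suc t) x" "v + Suc t \<le> K"
        then have "s ''b'' 0 \<le> int v \<longleftrightarrow> (\<exists>c<i. P c v)" "e \<le> int v \<longleftrightarrow> P i v"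
          using \<open>I i s\<close> e(2) by (simp_all add: I_def)
        then show "(s'(''c'' := (s' ''c'')(0 := int (Suc i)))) ''b'' 0 \<le> int v \<longleftrightarrow> (\<exists>c<Suc i. P c v)"
          by (auto simp: e(1) min_le_iff_disj less_Suc_eq)
      qed
      ultimately show ?case using post(1) by simp
    qed simp
  next
    case (3 i s)
    then show ?case using I(4)[OF 3(2)] by simp
  next
    case (4 u s)
    note E = I[OF 4(2)]
    have "correct_entry K m D (Suc t) x (s ''b'' 0)"
      using 4(2) by (simp add: correct_entry_def I_def P_def B)
    moreover have "u + 30 \<le> 400 * (m * m)"
    proof -
      have "u \<le> 300 * (m * m) + 12 * m + 9" using 4(1) by (simp add: algebra_simps)
      moreover have "m \<le> m * m" "1 \<le> m * m" using m by simp_all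
      ultimately show ?thesis by linarith
    qed
    moreover have addr: "aval (Arith Plus (Arith Times (Arith Plus (Var ''t'') (Const 1)) (Var ''N''))
        (Var ''s'')) s = int (Suc t * B ^ (m - 1) + x)"
      using E(2,3,6) by (simp add: algebra_simps)
    ultimately show ?case
      unfolding wp_Assign addr
    proof (intro conjI exI[of _ "s ''b'' 0"] allI impI, goal_cases)
      case (4 a)
      then show ?case using E(7)[of a] by simp
    qed (use E(5) in simp_all)
  qed
qed

definition sweep :: com where
  "sweep = For ''t'' (Var ''K'') (For ''s'' (Var ''N'') fill_cell)"

abbreviation sweep_vars :: "name set" where
  "sweep_vars \<equiv> insert ''t'' (insert ''s'' (insert ''h'' (insert ''c'' trial_vars)))"

lemma wp_level:
  assumes env: "env m n k d s0" and t: "s0 ''t'' 0 = int t" "t < k * n" and m: "m \<ge> 1"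
    and K: "K = k * n" and B: "B = K + 1" and D: "D = factor k d" "\<And>j. j < m \<Longrightarrow> D t j > 0"
    and h: "\<And>y. t > 0 \<Longrightarrow> y < B ^ (m - 1) \<Longrightarrow> correct_entry K m D t y (s0 ''h'' (int (t * B ^ (m - 1) + y)))"
  shows "wp (For ''s'' (Var ''N'') fill_cell) s0 (\<lambda>u s. u \<le> 500 * (B ^ (m - 1) * (m * m)) \<and>
    (\<forall>y<B ^ (m - 1). correct_entry K m D (Suc t) y (s ''h'' (int (Suc t * B ^ (m - 1) + y)))) \<and>
    (\<forall>a. a \<notin> insert ''s'' (insert ''h'' (insert ''c'' trial_vars)) \<longrightarrow> s a = s0 a))"
proof -
  define N where "N = B ^ (m - 1)"
  have N: "N \<ge> 1" by (simp add: N_def B)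
  define I where "I i s \<longleftrightarrow> (\<forall>a. a \<notin> insert ''s'' (insert ''h'' (insert ''c'' trial_vars)) \<longrightarrow> s a = s0 a) \<and>
    (\<forall>y<N. s ''h'' (int (t * N + y)) = s0 ''h'' (int (t * N + y))) \<and>
    (\<forall>y<i. correct_entry K m D (Suc t) y (s ''h'' (int (Suc t * N + y))))" for i and s :: mem
  have I: "env m n k d s" "s ''t'' 0 = int t" "s ''N'' 0 = int N"
    if "I i s" for i s
  proof -
    have fr: "s a = s0 a" if "a \<notin> insert ''s'' (insert ''h'' (insert ''c'' trial_vars))" for a
      using \<open>I i s\<close>[unfolded I_def, THEN conjunct1, rule_format, OF that] .
    show E: "env m n k d s" by (rule env_cong[OF env]) (auto intro!: fr)
    show "s ''t'' 0 = int t" "s ''N'' 0 = int N"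
      using t E B K by (simp_all add: fr env_def N_def)
  qed
  show ?thesis
  proof (rule wp_ForI[where I = I and n = N and T = "400 * (m * m)"], goal_cases)
    case 1
    show ?case by (simp add: I_def)
  next
    case (2 i s)
    note E = I[OF 2(2)]
    show ?case
    proof (rule wp_mono[OF wp_fill_cell[OF E(1,2) t(2) 2(3) m K B D]], goal_cases)
      case (2 y)
      then show ?case using h[of y] \<open>I i s\<close> by (simp add: I_def N_def)
    next
      case (3 u s')
      note post = 3[THEN conjunct1] 3[THEN conjunct2, THEN conjunct1]
        3[THEN conjunct2, THEN conjunct2, rule_format]
      from post(2) obtain e where e: "correct_entry K m D (Suc t) i e"
        "s' ''h'' = (s ''h'')(int (Suc t * N + i) := e)" unfolding N_def by (elim exE conjE)
      note fr = post(3)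
      have "s' ''s'' 0 = int i" using fr[of "''s''"] \<open>s ''s'' 0 = int i\<close> by simp
      moreover have "I (Suc i) (s'(''s'' := (s' ''s'')(0 := int (Suc i))))"
      proof -
        have h': "s' ''h'' (int (t * N + y)) = s ''h'' (int (t * N + y))" if "y < N" for y
        proof -
          have "int (t * N + y) \<noteq> int (Suc t * N + i)" unfolding of_nat_eq_iff using that by simp
          then show ?thesis unfolding e(2) by (rule fun_upd_other)
        qed
        have h'': "correct_entry K m D (Suc t) y (s' ''h'' (int (Suc t * N + y)))" if "y < Suc i" for y
        proof (cases "y = i")
          case True
          then show ?thesis using e by simp
        next
          case False
          then have "int (Suc t * N + y) \<noteq> int (Suc t * N + i)" unfolding of_nat_eq_iff by simp
          then have "s' ''h'' (int (Suc t * N + y)) = s ''h'' (int (Suc t * N + y))"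
            unfolding e(2) by (rule fun_upd_other)
          then show ?thesis using False that \<open>I i s\<close> by (simp add: I_def)
        qed
        show ?thesis
          unfolding I_def
        proof (intro conjI allI impI)
          fix a assume a: "a \<notin> insert ''s'' (insert ''h'' (insert ''c'' trial_vars))"
          have "s a = s0 a" by (rule \<open>I i s\<close>[unfolded I_def, THEN conjunct1, rule_format, OF a])
          then show "(s'(''s'' := (s' ''s'')(0 := int (Suc i)))) a = s0 a"
            using fr[of a] a by simp
        next
          fix y assume "y < N"
          moreover have "s ''h'' (int (t * N + y)) = s0 ''h'' (int (t * N + y))"
            using \<open>I i s\<close>[unfolded I_def, THEN conjunct2, THEN conjunct1] \<open>y < N\<close> by blast
          ultimately show "(s'(''s'' := (s' ''s'')(0 := int (Suc i)))) ''h'' (int (t * N + y)) =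
            s0 ''h'' (int (t * N + y))"
            using h'[of y] by simp
        next
          fix y assume "y < Suc i"
          then show "correct_entry K m D (Suc t) y
            ((s'(''s'' := (s' ''s'')(0 := int (Suc i)))) ''h'' (int (Suc t * N + y)))"
            using h''[of y] by simp
        qed
      qed
      ultimately show ?case using post(1) by simp
    qed simp
  next
    case (3 i s)
    then show ?case using I(3)[OF 3(2)] by simp
  next
    case (4 u s)
    have "u \<le> 400 * (N * (m * m)) + 12 * N + 9" using 4(1) by (simp add: algebra_simps)
    moreover have "N \<le> N * (m * m)" "1 \<le> N * (m * m)" using m N by simp_all
    ultimately have "u \<le> 500 * (N * (m * m))" by linarith
    then show ?case using 4(2) by (simp add: I_def N_def)
  qed
qed

lemma wp_sweep:
  assumes env: "env m n k d s0" and m: "m \<ge> 1"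
    and K: "K = k * n" "K \<ge> 1" and B: "B = K + 1"
    and D: "D = factor k d" "\<And>t j. t < K \<Longrightarrow> j < m \<Longrightarrow> D t j > 0"
  shows "wp sweep s0 (\<lambda>u s. u \<le> 600 * (K * (B ^ (m - 1) * (m * m))) \<and>
    (s ''h'' (int (K * B ^ (m - 1))) \<le> 0 \<longleftrightarrow> feasible m D K (\<lambda>_. 0)) \<and>
    (\<forall>a. a \<notin> sweep_vars \<longrightarrow> s a = s0 a))"
proof -
  define N where "N = B ^ (m - 1)"
  have N: "N \<ge> 1" by (simp add: N_def B)
  define I where "I i s \<longleftrightarrow> (\<forall>a. a \<notin> sweep_vars \<longrightarrow> s a = s0 a) \<and>
    (i > 0 \<longrightarrow> (\<forall>y<N. correct_entry K m D i y (s ''h'' (int (i * N + y)))))" for i and s :: mem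
  have I: "env m n k d s" "s ''K'' 0 = int K"
    if "I i s" for i s
  proof -
    have fr: "s a = s0 a" if "a \<notin> sweep_vars" for a
      using \<open>I i s\<close>[unfolded I_def, THEN conjunct1, rule_format, OF that] .
    show E: "env m n k d s" by (rule env_cong[OF env]) (auto intro!: fr)
    show "s ''K'' 0 = int K" using E K by (simp add: env_def)
  qed
  show ?thesis
    unfolding sweep_def
  proof (rule wp_ForI[where I = I and n = K and T = "500 * (N * (m * m))"], goal_cases)
    case 1
    show ?case by (simp add: I_def)
  next
    case (2 i s)
    have "i < k * n" using 2 K by simp
    show ?case
    proof (rule wp_mono[OF wp_level[OF I(1)[OF 2(2)] 2(3) \<open>i < k * n\<close> m K(1) B D(1) D(2)]], goal_cases)
      case 1
      then show ?case using \<open>i < K\<close> by simp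
    next
      case (3 y)
      then show ?case using \<open>I i s\<close> by (simp add: I_def N_def)
    next
      case (4 u s')
      note post = 4[THEN conjunct1] 4[THEN conjunct2, THEN conjunct1, rule_format]
        4[THEN conjunct2, THEN conjunct2, rule_format]
      have "s' ''t'' 0 = int i" using post(3)[of "''t''"] \<open>s ''t'' 0 = int i\<close> by simp
      moreover have "I (Suc i) (s'(''t'' := (s' ''t'')(0 := int (Suc i))))"
        unfolding I_def
      proof (intro conjI allI impI)
        fix a assume a: "a \<notin> sweep_vars"
        have "s a = s0 a" by (rule \<open>I i s\<close>[unfolded I_def, THEN conjunct1, rule_format, OF a])
        then show "(s'(''t'' := (s' ''t'')(0 := int (Suc i)))) a = s0 a"
          using post(3)[of a] a by simp
      next
        fix y assume "y < N"
        then show "correct_entry K m D (Suc i) y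
          ((s'(''t'' := (s' ''t'')(0 := int (Suc i)))) ''h'' (int (Suc i * N + y)))"
          using post(2)[of y] by (simp add: N_def)
      qed
      ultimately show ?case using post(1) by (simp add: N_def)
    qed simp
  next
    case (3 i s)
    then show ?case using I(2)[OF 3(2)] by simp
  next
    case (4 u s)
    have "u \<le> 500 * (K * (N * (m * m))) + 12 * K + 9" using 4(1) by (simp add: algebra_simps)
    moreover have "K \<le> K * (N * (m * m))" "1 \<le> K * (N * (m * m))" using m N K by simp_all
    ultimately have "u \<le> 600 * (K * (N * (m * m)))" by linarith
    moreover have "correct_entry K m D K 0 (s ''h'' (int (K * N)))"
      using 4(2)[unfolded I_def, THEN conjunct2, rule_format, of 0] K(2) N by simp
    then have "s ''h'' (int (K * N)) \<le> 0 \<longleftrightarrow> feasible m D K (thresholds (K + 1) (m - 1) 0 0)"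
      by (auto simp: correct_entry_def in_box_def digit_def)
    moreover have "thresholds (K + 1) (m - 1) 0 0 = (\<lambda>_. 0)" by (auto simp: thresholds_def digit_def)
    ultimately show ?case using 4(2) by (simp add: I_def N_def)
  qed
qed

definition program :: com where
  "program = Seq (Store ''K'' (Arith Times (Var ''k'') (Var ''n'')))
    (If (Less (Var ''K'') (Var ''m'')) Skip
      (Seq (Store ''B'' (Arith Plus (Var ''K'') (Const 1)))
      (Seq (Store ''N'' (Const 1))
      (Seq (For ''r'' pred_m (Store ''N'' (Arith Times (Var ''N'') (Var ''B''))))
      (Seq sweep
        (Select ''answer''
          (Less (Cell ''h'' (Arith Times (Var ''K'') (Var ''N''))) (Const 1)) (Const 1) (Const 0)))))))"

lemma wp_program:
  assumes m: "m \<ge> 1" and n: "n \<ge> 1" and k: "k \<ge> 1"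
    and d: "\<And>i j. i < n \<Longrightarrow> j < m \<Longrightarrow> d i j \<ge> 1" and K: "K = k * n"
  shows "wp program (input_mem m n k d) (\<lambda>u s.
    s ''answer'' 0 = (if can_save_all_leaves m n k d then 1 else 0) \<and>
    u \<le> (if K < m then 20 else 700 * (K * ((K + 1) ^ (m - 1) * (m * m)))))"
proof -
  define D where "D = factor k d"
  have D: "D t j > 0" if "t < K" "j < m" for t j
    using that d[of "t div k" j]
    by (auto simp: D_def factor_def less_mult_imp_div_less mult.commute Suc_le_eq K)
  have save: "can_save_all_leaves m n k d \<longleftrightarrow> feasible m D K (\<lambda>_. 0)"
    using can_save_iff_feasible[OF m k d] by (simp add: D_def K)
  have K1: "K \<ge> 1" using n k K by simp
  define s0 where "s0 = (input_mem m n k d)(''K'' := (input_mem m n k d ''K'')(0 := int K))"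
  have s0: "s0 ''K'' 0 = int K" "s0 ''m'' 0 = int m" "s0 ''k'' 0 = int k" "s0 ''answer'' 0 = 0"
    by (simp_all add: s0_def input_mem_def)
  have d0: "s0 ''d'' (int (i * m + j)) = int (d i j)" if "i < n" "j < m" for i j
  proof -
    have "i * m + j < Suc i * m" using that by simp
    also have "\<dots> \<le> n * m" using that by (intro mult_right_mono) auto
    finally have "int (i * m + j) < int (n * m)" by (simp only: of_nat_less_iff)
    moreover have "(i * m + j) div m = i" "(i * m + j) mod m = j" using that by simp_all
    ultimately show ?thesis by (simp add: s0_def input_mem_def del: of_nat_add of_nat_mult)
  qed
  have start: "(input_mem m n k d)(''K'' := (input_mem m n k d ''K'')
      (aval (Const 0) (input_mem m n k d) := aval (Arith Times (Var ''k'') (Var ''n'')) (input_mem m n k d))) = s0"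
    by (simp add: s0_def input_mem_def K)
  show ?thesis
  proof (cases "K < m")
    case True
    then have "\<not> can_save_all_leaves m n k d" using not_feasible_zero[OF D] save by simp
    then show ?thesis
      unfolding program_def
      by (intro wp_Seq[THEN iffD2] wp_Assign[THEN iffD2], unfold start, intro wp_If[THEN iffD2])
        (use True s0 in \<open>simp add: wp_Skip\<close>)
  next
    case False
    define I where "I i s \<longleftrightarrow> s ''N'' 0 = int ((K + 1) ^ i) \<and> s ''B'' 0 = int (K + 1) \<and>
      (\<forall>a. a \<notin> {''N'', ''B'', ''r''} \<longrightarrow> s a = s0 a)" for i and s :: mem
    let ?rest = "Seq (For ''r'' pred_m (Store ''N'' (Arith Times (Var ''N'') (Var ''B''))))
      (Seq sweep
        (Select ''answer''
          (Less (Cell ''h'' (Arith Times (Var ''K'') (Var ''N''))) (Const 1)) (Const 1) (Const 0)))"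
    let ?s1 = "s0(''B'' := (s0 ''B'')(0 := int (K + 1)), ''N'' := (s0 ''N'')(0 := 1))"
    have rest: "wp ?rest ?s1 (\<lambda>u s. s ''answer'' 0 = (if can_save_all_leaves m n k d then 1 else 0) \<and>
      u + 30 \<le> 700 * (K * ((K + 1) ^ (m - 1) * (m * m))))"
    proof (rule wp_Seq[THEN iffD2], rule wp_ForI[where I = I and n = "m - 1" and T = 7], goal_cases)
      case 1
      show ?case by (simp add: I_def)
    next
      case (2 i s)
      note I = 2(2)[unfolded I_def, THEN conjunct1] 2(2)[unfolded I_def, THEN conjunct2, THEN conjunct1]
        2(2)[unfolded I_def, THEN conjunct2, THEN conjunct2, rule_format]
      show ?case
        unfolding wp_Assign I_def
      proof (intro conjI allI impI, goal_cases)
        case (5 a)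
        then show ?case using I(3)[of a] by simp
      qed (use I(1,2) 2(3) in \<open>simp_all add: algebra_simps\<close>)
    next
      case (3 i s)
      have "s ''m'' 0 = int m"
        using 3(2)[unfolded I_def, THEN conjunct2, THEN conjunct2, rule_format, of "''m''"] s0 by simp
      then show ?case using m by (simp add: pred_m_def of_nat_diff)
    next
      case (4 u s)
      note fr = 4(2)[unfolded I_def, THEN conjunct2, THEN conjunct2, rule_format]
      have env: "env m n k d s"
        unfolding env_def
      proof (intro conjI allI impI)
        show "s ''m'' 0 = int m" "s ''k'' 0 = int k" "s ''K'' 0 = int (k * n)"
          using s0 by (simp_all add: fr K)
        show "s ''B'' 0 = int (k * n + 1)" "s ''N'' 0 = int ((k * n + 1) ^ (m - 1))"
          using 4(2)[unfolded I_def, THEN conjunct2, THEN conjunct1]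
            4(2)[unfolded I_def, THEN conjunct1] unfolding K by simp_all
        fix i j assume "i < n" "j < m"
        then show "s ''d'' (int (i * m + j)) = int (d i j)"
          using d0 fr[of "''d''"] by simp
      qed
      show ?case
      proof (rule wp_Seq[THEN iffD2], rule wp_mono[OF wp_sweep[OF env m K K1 refl D_def D]], goal_cases)
        case (3 u' s')
        note fr' = 3[THEN conjunct2, THEN conjunct2, rule_format]
        have "s' ''K'' 0 = int K" "s' ''N'' 0 = int ((K + 1) ^ (m - 1))"
          using env by (simp_all add: fr' env_def K)
        moreover have "u + u' + 50 \<le> 700 * (K * ((K + 1) ^ (m - 1) * (m * m)))"
        proof -
          let ?X = "K * ((K + 1) ^ (m - 1) * (m * m))"
          have "m * m * 1 \<le> ?X" using K1 by (simp add: mult_le_mono)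
          moreover have "u \<le> 21 * m + 20" using 4(1) by (simp add: pred_m_def algebra_simps)
          moreover have "m \<le> m * m" "1 \<le> m * m" using m by simp_all
          moreover have "u' \<le> 600 * ?X" using 3 by simp
          ultimately show ?thesis by linarith
        qed
        moreover note 3[THEN conjunct2, THEN conjunct1]
        ultimately show ?case
          unfolding wp_Select save by (cases "feasible m D K (\<lambda>_. 0)") simp_all
      qed simp_all
    qed
    have nb: "\<not> bval (Less (Var ''K'') (Var ''m'')) s0" using False s0 by simp
    have inits: "(s0(''B'' := (s0 ''B'')(aval (Const 0) s0 := aval (Arith Plus (Var ''K'') (Const 1)) s0))) =
        s0(''B'' := (s0 ''B'')(0 := int (K + 1)))"
      using s0 by (simp add: add.commute)
    show ?thesis
      unfolding program_def
    proof (rule wp_Seq[THEN iffD2], rule wp_Assign[THEN iffD2], unfold start,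
        rule wp_If[THEN iffD2], unfold if_not_P[OF nb], rule wp_Seq[THEN iffD2],
        rule wp_Assign[THEN iffD2], unfold inits, rule wp_Seq[THEN iffD2],
        rule wp_Assign[THEN iffD2], rule wp_transfer[OF rest], goal_cases)
      case 1
      show ?case by simp
    next
      case (2 u s)
      then show ?case using False by simp
    qed
  qed
qed

section \<open>The running time\<close>

lemma power_Suc_le:
  assumes "p \<le> K" "K \<ge> 1"
  shows "(K + 1) ^ p \<le> 3 * K ^ p"
proof -
  have "(1 + 1 / real K) ^ p \<le> (1 + 1 / real K) ^ K" using assms by (intro power_increasing) auto
  also have "\<dots> \<le> exp (1 / real K) ^ K" by (intro power_mono exp_ge_add_one_self) auto
  also have "\<dots> = exp 1" using assms by (simp flip: exp_of_nat_mult)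
  also have "\<dots> \<le> 3" by (rule exp_le)
  finally have "(1 + 1 / real K) ^ p * real K ^ p \<le> 3 * real K ^ p" by (intro mult_right_mono) auto
  moreover have "(1 + 1 / real K) ^ p * real K ^ p = (real K + 1) ^ p"
    using assms by (simp add: power_mult_distrib[symmetric] distrib_right)
  ultimately have "real ((K + 1) ^ p) \<le> real (3 * K ^ p)" by (simp add: add.commute)
  then show ?thesis by (simp only: of_nat_le_iff)
qed

lemma le_choose:
  assumes "m \<ge> 1" "k \<ge> 1"
  shows "m \<le> (m + k - 1) choose (m - 1)"
proof -
  obtain M where M: "m = Suc M" using assms by (cases m) auto
  have "m = Suc M choose M" using M by (simp add: binomial_Suc_n)
  also have "\<dots> \<le> (M + k) choose M"
    by (rule binomial_right_mono) (use assms in simp)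
  finally show ?thesis by (simp add: M)
qed

text \<open>
  The constant is the 700 of the program times the 3 that is lost in passing from \<open>K + 1\<close> to \<open>K\<close>.
\<close>

theorem mainTheorem4:
  "\<exists>(prog :: com) (C :: nat). \<forall>(m :: nat) (n :: nat) (k :: nat) (d :: nat \<Rightarrow> nat \<Rightarrow> nat).
     m \<ge> 1 \<and> n \<ge> 1 \<and> k \<ge> 1 \<and> (\<forall>i<n. \<forall>j<m. d i j \<ge> 1) \<longrightarrow>
     (\<exists>t s. exec prog (input_mem m n k d) t s \<and>
            s ''answer'' 0 = (if can_save_all_leaves m n k d then 1 else 0) \<and>
            t \<le> C * (m * ((m + k - 1) choose (m - 1)) * n * (k * n) ^ m))"
proof (rule exI[of _ program], rule exI[of _ 2100], intro allI impI, elim conjE)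
  fix m n k :: nat and d :: "nat \<Rightarrow> nat \<Rightarrow> nat"
  assume *: "1 \<le> m" "1 \<le> n" "1 \<le> k" "\<forall>i<n. \<forall>j<m. 1 \<le> d i j"
  define K where "K = k * n"
  define X where "X = m * ((m + k - 1) choose (m - 1)) * n * K ^ m"
  have K: "K \<ge> 1" using * by (simp add: K_def)
  have "m * m \<le> m * ((m + k - 1) choose (m - 1))" using le_choose[OF *(1,3)] by simp
  then have X: "m * m * 1 * K ^ m \<le> X" unfolding X_def using * by (intro mult_mono) auto
  have "(if K < m then 20 else 700 * (K * ((K + 1) ^ (m - 1) * (m * m)))) \<le> 2100 * X"
  proof (cases "K < m")
    case True
    have "1 \<le> m * m * 1 * K ^ m" using * K by simp
    then have "1 \<le> X" using X by (rule order_trans)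
    then show ?thesis using True by simp
  next
    case False
    have "K * ((K + 1) ^ (m - 1) * (m * m)) \<le> K * (3 * K ^ (m - 1) * (m * m))"
      using power_Suc_le[of "m - 1" K] K False by (intro mult_left_mono mult_right_mono) auto
    also have "\<dots> = 3 * (m * m * 1 * K ^ m)" using * by (cases m) (auto simp: algebra_simps)
    also have "\<dots> \<le> 3 * X" using X by simp
    finally show ?thesis unfolding if_not_P[OF False] by linarith
  qed
  moreover have "wp program (input_mem m n k d) (\<lambda>u s.
      s ''answer'' 0 = (if can_save_all_leaves m n k d then 1 else 0) \<and>
      u \<le> (if K < m then 20 else 700 * (K * ((K + 1) ^ (m - 1) * (m * m)))))"
    using * by (intro wp_program) (simp_all add: K_def)
  ultimately have "wp program (input_mem m n k d) (\<lambda>u s.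
      s ''answer'' 0 = (if can_save_all_leaves m n k d then 1 else 0) \<and> u \<le> 2100 * X)"
    by (elim wp_mono) (blast intro: order_trans)
  then show "\<exists>t s. exec program (input_mem m n k d) t s \<and>
            s ''answer'' 0 = (if can_save_all_leaves m n k d then 1 else 0) \<and>
            t \<le> 2100 * (m * ((m + k - 1) choose (m - 1)) * n * (k * n) ^ m)"
    unfolding wp_def X_def K_def .
qed

end
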